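(* Let $p$ be a prime. There is no finite $p$-group $G$ of order at most $p^6$ such that $Z(G)$ is not contained in $G'$, $G$ has nilpotency class at least $3$, and $Z(\mathrm{Inn}(G))=\mathrm{Aut}_c^{Z}(G)<\mathrm{Aut}_c(G)$ (i.e., $\mathrm{Aut}_c^{Z}(G)$ equals $Z(\mathrm{Inn}(G))$ and is a proper subgroup of $\mathrm{Aut}_c(G)$).
   Context: $G'$ is the commutator subgroup and $Z(G)$ the center of $G$. $\mathrm{Inn}(G)$ is the group of inner automorphisms of $G$. An automorphism $\alpha$ of $G$ is central if $x^{-1}\alpha(x)\in Z(G)$ for all $x\in G$; $\mathrm{Aut}_c(G)$ denotes the group of all central automorphisms of $G$, and $\mathrm{Aut}_c^{Z}(G)$ the subgroup of central automorphisms fixing every element of $Z(G)$. *)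

theory Defs
  imports "HOL-Algebra.Algebra"
begin

definition grp_center :: "('a, 'b) monoid_scheme \<Rightarrow> 'a set" where
  "grp_center G = {z \<in> carrier G. \<forall>x \<in> carrier G. x \<otimes>\<^bsub>G\<^esub> z = z \<otimes>\<^bsub>G\<^esub> x}"

definition comm_subgroup :: "('a, 'b) monoid_scheme \<Rightarrow> 'a set \<Rightarrow> 'a set \<Rightarrow> 'a set" where
  "comm_subgroup G H K = generate G
     (\<Union>h \<in> H. \<Union>k \<in> K. {inv\<^bsub>G\<^esub> h \<otimes>\<^bsub>G\<^esub> inv\<^bsub>G\<^esub> k \<otimes>\<^bsub>G\<^esub> h \<otimes>\<^bsub>G\<^esub> k})"

primrec lower_central :: "('a, 'b) monoid_scheme \<Rightarrow> nat \<Rightarrow> 'a set" where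
  "lower_central G 0 = carrier G"
| "lower_central G (Suc n) = comm_subgroup G (lower_central G n) (carrier G)"

text \<open>Nilpotency class: least c with gamma_(c+1)(G) = 1.\<close>
definition nilpotency_class :: "('a, 'b) monoid_scheme \<Rightarrow> nat" where
  "nilpotency_class G = (LEAST c. lower_central G c = {\<one>\<^bsub>G\<^esub>})"

definition inner_aut :: "('a, 'b) monoid_scheme \<Rightarrow> 'a \<Rightarrow> ('a \<Rightarrow> 'a)" where
  "inner_aut G g = (\<lambda>x \<in> carrier G. g \<otimes>\<^bsub>G\<^esub> x \<otimes>\<^bsub>G\<^esub> inv\<^bsub>G\<^esub> g)"

definition InnGroup :: "('a, 'b) monoid_scheme \<Rightarrow> ('a \<Rightarrow> 'a) monoid" where
  "InnGroup G = (AutoGroup G)\<lparr>carrier := inner_aut G ` carrier G\<rparr>"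

definition central_auts :: "('a, 'b) monoid_scheme \<Rightarrow> ('a \<Rightarrow> 'a) set" where
  "central_auts G = {\<alpha> \<in> auto G. \<forall>x \<in> carrier G. inv\<^bsub>G\<^esub> x \<otimes>\<^bsub>G\<^esub> \<alpha> x \<in> grp_center G}"

definition central_auts_Z :: "('a, 'b) monoid_scheme \<Rightarrow> ('a \<Rightarrow> 'a) set" where
  "central_auts_Z G = {\<alpha> \<in> central_auts G. \<forall>z \<in> grp_center G. \<alpha> z = z}"

end

theory Submission
  imports Defs
begin

text \<open>
  Let \<open>Z\<close> be the center and \<open>Z2\<close> the second center of \<open>G\<close>. A homomorphism \<open>f : G \<rightarrow> Z\<close> that is
  trivial on \<open>Z\<close> gives the central automorphism \<open>x \<mapsto> f(x) x\<close> fixing \<open>Z\<close>, so by hypothesis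
  \<open>f = [u, -]\<close> for some \<open>u \<in> Z2\<close>.

  Since \<open>Z\<close> meets \<open>G'\<close> nontrivially but is not contained in it, \<open>|Z| \<ge> p^2\<close>. As \<open>G/Z2\<close> is not
  cyclic, there are two homomorphisms \<open>f1 = [u1, -]\<close>, \<open>f2 = [u2, -]\<close> that are trivial on \<open>Z2\<close>, take
  values in a subgroup \<open>P \<le> Z\<close> of order \<open>p\<close> and have different kernels. Then
  \<open>Z < \<langle>Z, u2\<rangle> < \<langle>Z, u2, u1\<rangle> \<le> Z2\<close> and \<open>Z2\<close> has index at least \<open>p^2\<close>, so \<open>|G| \<le> p^6\<close> forces
  \<open>|Z| = p^2\<close>, \<open>Z2 = \<langle>Z, u1, u2\<rangle> = ker f1 \<inter> ker f2\<close> and \<open>|G/Z2| = p^2\<close>. Hence every \<open>f\<close> as above is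
  trivial on \<open>Z2\<close> and has values in \<open>P\<close>. The second property makes \<open>Z\<close> cyclic, since an element of
  order \<open>p\<close> outside \<open>P\<close> would be a value of some \<open>f\<close>. The first one then fails: with
  \<open>G = \<langle>Z2, a, b\<rangle>\<close>, a nontrivial homomorphism \<open>Z2 \<rightarrow> P\<close> that kills \<open>Z\<close> and \<open>[a, b]\<close> extends to \<open>a\<close>
  and then to \<open>b\<close>, because elements of \<open>P\<close> have \<open>p\<close>-th roots in \<open>Z\<close>.
\<close>

section \<open>Fixed points and normalizers in finite p-groups\<close>

locale finite_p_group = group G for G (structure) +
  fixes p n :: nat
  assumes prime_p: "Factorial_Ring.prime p"
    and order_G: "order G = p ^ n"
begin

lemma finite_G: "finite (carrier G)"
  using order_G prime_p order_gt_0_iff_finite prime_gt_0_nat by simp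

lemma subgroup_card_power:
  assumes "subgroup H G"
  obtains k where "card H = p ^ k" "k \<le> n"
  using lagrange[OF assms] order_G prime_p divides_primepow_nat
  by (metis dvd_triv_right)

lemma subgroup_p_group:
  assumes "subgroup H G"
  obtains m where "finite_p_group (G\<lparr>carrier := H\<rparr>) p m"
proof -
  obtain k where "card H = p ^ k" using subgroup_card_power[OF assms] by blast
  then have "finite_p_group (G\<lparr>carrier := H\<rparr>) p k"
    using subgroup_imp_group[OF assms] prime_p
    by (simp add: finite_p_group_def finite_p_group_axioms_def order_def)
  then show thesis by (rule that)
qed

text \<open>Both orders are powers of \<open>p\<close>, so a strict inclusion raises the exponent by
  at least one. The lower bounds in the later counting arguments come from this.\<close>

lemma psubgroup_card_ge:
  assumes "subgroup H G" "subgroup K G" "H \<subset> K"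
  shows "p * card H \<le> card K"
proof -
  obtain i where i: "card H = p ^ i" using subgroup_card_power[OF assms(1)] by blast
  obtain j where j: "card K = p ^ j" using subgroup_card_power[OF assms(2)] by blast
  have "finite K" using assms(2) finite_G subgroup.subset finite_subset by metis
  then have "p ^ i < p ^ j" using psubset_card_mono[OF _ assms(3)] i j by simp
  then have "i < j" using prime_p prime_gt_1_nat power_less_imp_less_exp by metis
  then have "p ^ Suc i \<le> p ^ j"
    using prime_p prime_gt_0_nat by (intro power_increasing) (auto simp: Suc_leI)
  then show ?thesis using i j by simp
qed

lemma pow_order_eq_one:
  assumes "x \<in> carrier G"
  shows "x [^] (p ^ n) = \<one>"
  using pow_order_eq_1[OF assms] order_G by simp

end

text \<open>\<open>BijGroup E\<close> consists of extensional functions, hence the restriction to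
  \<open>E\<close> in the conclusion. Bijectivity comes from \<open>\<psi> (inv g)\<close>, which
  inverts \<open>\<psi> g\<close> on both sides.\<close>

lemma (in group) group_actionI:
  assumes closed: "\<And>g x. g \<in> carrier G \<Longrightarrow> x \<in> E \<Longrightarrow> \<psi> g x \<in> E"
    and one: "\<And>x. x \<in> E \<Longrightarrow> \<psi> \<one> x = x"
    and comp: "\<And>g h x. g \<in> carrier G \<Longrightarrow> h \<in> carrier G \<Longrightarrow> x \<in> E \<Longrightarrow> \<psi> (g \<otimes> h) x = \<psi> g (\<psi> h x)"
  shows "group_action G E (\<lambda>g. \<lambda>x \<in> E. \<psi> g x)"
proof -
  have bij: "(\<lambda>x \<in> E. \<psi> g x) \<in> Bij E" if g: "g \<in> carrier G" for g
  proof -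
    have 1: "\<psi> (inv g) (\<psi> g x) = x" "\<psi> g (\<psi> (inv g) x) = x" if "x \<in> E" for x
      using that g comp[of "inv g" g x] comp[of g "inv g" x] one by simp_all
    have "bij_betw (\<lambda>x \<in> E. \<psi> g x) E E"
      by (rule bij_betw_byWitness[where f' = "\<psi> (inv g)"]) (use 1 closed g in auto)
    then show ?thesis by (simp add: Bij_def)
  qed
  have "(\<lambda>g. \<lambda>x \<in> E. \<psi> g x) \<in> hom G (BijGroup E)"
    using bij closed comp
    by (auto simp: hom_def BijGroup_def compose_def fun_eq_iff restrict_def)
  then show ?thesis
    by (simp add: group_action_def group_hom_def group_hom_axioms_def group_BijGroup group_axioms)
qed

text \<open>By the orbit-stabilizer theorem every orbit has size a power of \<open>p\<close>, so
  orbits with more than one point have size divisible by \<open>p\<close>. The set \<open>E\<close>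
  is the disjoint union of these and of the fixed points.\<close>

lemma (in finite_p_group) card_fixed_points_dvd:
  assumes "group_action G E \<phi>" "finite E" "p dvd card E"
  shows "p dvd card {x \<in> E. \<forall>g \<in> carrier G. \<phi> g x = x}"
proof -
  interpret A: group_action G E \<phi> by fact
  let ?F = "{x \<in> E. \<forall>g \<in> carrier G. \<phi> g x = x}"
  let ?O = "orbits G E \<phi>"
  let ?B = "{S \<in> ?O. card S \<noteq> 1}"
  have fin_O: "finite ?O" using assms(2) by (simp add: orbits_def)
  have orb_sub: "S \<subseteq> E" if "S \<in> ?O" for S using that A.orbits_coverture by blast
  have dvd: "p dvd card S" if S: "S \<in> ?B" for S
  proof -
    obtain x where x: "x \<in> E" "S = orbit G \<phi> x" using S by (auto simp: orbits_def)
    have "card S dvd p ^ n" using A.orbit_stabilizer_theorem[OF x(1)] x(2) order_G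
      by (metis dvd_triv_left)
    then obtain k where "card S = p ^ k" using divides_primepow_nat prime_p by blast
    with S show ?thesis by (cases k) auto
  qed
  have single: "S = {x}" if "S \<in> ?O" "card S = 1" "x \<in> S" for S x
    using that by (metis card_1_singletonE singletonD)
  have F_iff: "x \<in> ?F \<longleftrightarrow> x \<in> E \<and> orbit G \<phi> x = {x}" for x
    using A.orbit_refl[of x] unfolding orbit_def by auto
  have E_eq: "E = ?F \<union> \<Union>?B"
  proof
    show "E \<subseteq> ?F \<union> \<Union>?B"
    proof
      fix x assume x: "x \<in> E"
      have o: "orbit G \<phi> x \<in> ?O" "x \<in> orbit G \<phi> x"
        using x A.orbit_refl by (auto simp: orbits_def)
      show "x \<in> ?F \<union> \<Union>?B"
        using o single[OF o(1) _ o(2)] F_iff x by blast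
    qed
    show "?F \<union> \<Union>?B \<subseteq> E" using orb_sub by blast
  qed
  have disj: "?F \<inter> \<Union>?B = {}"
  proof -
    { fix x S assume x: "x \<in> ?F" "S \<in> ?B" "x \<in> S"
      have "orbit G \<phi> x = {x}" "x \<in> E" using x(1) F_iff by auto
      then have "{x} \<in> ?O" by (auto simp: orbits_def)
      then have "S = {x}" using A.disjoint_union[of S "{x}"] x by auto
      with x have False by simp }
    then show ?thesis by blast
  qed
  have "p dvd card (\<Union>?B)"
  proof -
    have "card (\<Union>?B) = (\<Sum>S \<in> ?B. card S)"
      using A.disjoint_union finite_subset[OF orb_sub assms(2)]
      by (intro card_Union_disjoint) (auto simp: pairwise_def disjnt_def)
    then show ?thesis using dvd by (metis (no_types, lifting) dvd_sum)
  qed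
  moreover have "card E = card ?F + card (\<Union>?B)"
    using card_Un_disjoint[OF _ _ disj] E_eq assms(2) by (metis (no_types, lifting) finite_Un)
  ultimately show ?thesis using assms(3) by (simp add: dvd_add_left_iff)
qed

text \<open>Under conjugation by \<open>G\<close> the fixed points in \<open>N\<close> are its
  central elements. Their number is divisible by \<open>p\<close>, so \<one> is not the only
  one.\<close>

lemma (in finite_p_group) normal_inter_center:
  assumes "N \<lhd> G" "N \<noteq> {\<one>}"
  shows "\<exists>z \<in> N \<inter> grp_center G. z \<noteq> \<one>"
proof -
  have N: "subgroup N G" using assms(1) by (rule normal_imp_subgroup)
  note sub = subgroup.mem_carrier[OF N]
  have fin: "finite N" using finite_G N subgroup.subset finite_subset by metis
  obtain k where k: "card N = p ^ k" using subgroup_card_power[OF N] by blast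
  have "k \<noteq> 0"
  proof
    assume "k = 0"
    then have "card N = 1" using k by simp
    then show False using assms(2) subgroup.one_closed[OF N] by (metis card_1_singletonE singletonD)
  qed
  then have dvd: "p dvd card N" using k by simp
  have act: "group_action G N (\<lambda>g. \<lambda>x \<in> N. g \<otimes> x \<otimes> inv g)"
  proof (rule group_actionI)
    show "g \<otimes> x \<otimes> inv g \<in> N" if "g \<in> carrier G" "x \<in> N" for g x
      using normal.inv_op_closed2[OF assms(1)] that by blast
  qed (use sub in \<open>auto simp: inv_mult_group m_assoc\<close>)
  let ?F = "{x \<in> N. \<forall>g \<in> carrier G. (\<lambda>x \<in> N. g \<otimes> x \<otimes> inv g) x = x}"
  have "p dvd card ?F" by (rule card_fixed_points_dvd[OF act fin dvd])
  moreover have one: "\<one> \<in> ?F" using subgroup.one_closed[OF N] by auto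
  ultimately have "?F \<noteq> {\<one>}" using prime_p by (metis card.empty card.insert empty_iff finite.emptyI
        not_prime_unit One_nat_def)
  then obtain z where z: "z \<in> ?F" "z \<noteq> \<one>" using one by blast
  have "z \<in> grp_center G"
  proof -
    have "g \<otimes> z = z \<otimes> g" if "g \<in> carrier G" for g
      using z that sub by (auto simp: inv_solve_right' dest: bspec[of _ _ g])
    then show ?thesis using z sub by (auto simp: grp_center_def)
  qed
  then show ?thesis using z by blast
qed

text \<open>Normalizers grow: \<open>H\<close> acts on its right cosets by right multiplication, and
  their number is a positive power of \<open>p\<close>. The coset \<open>H\<close> is fixed, so
  there is another fixed coset \<open>H #> y\<close>, and then \<open>y\<close> normalizes
  \<open>H\<close>.\<close>

lemma (in finite_p_group) ex_normalizing_element: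
  assumes H: "subgroup H G" and "H \<noteq> carrier G"
  shows "\<exists>y \<in> carrier G - H. (\<forall>h \<in> H. y \<otimes> h \<otimes> inv y \<in> H)"
proof -
  note sub = subgroup.mem_carrier[OF H]
  have Hsub: "H \<subseteq> carrier G" using H subgroup.subset by blast
  obtain k where k: "card H = p ^ k" "k \<le> n" using subgroup_card_power[OF H] by blast
  have "k \<noteq> n"
    using k order_G assms(2) Hsub finite_G card_subset_eq unfolding order_def by metis
  then have kn: "k < n" using k by simp
  let ?E = "rcosets H"
  have "card ?E * p ^ k = p ^ (n - k) * p ^ k"
    using lagrange[OF H] order_G k by (simp add: power_add[symmetric])
  then have "card ?E = p ^ (n - k)" using prime_p prime_gt_0_nat by auto
  then have dvd: "p dvd card ?E" using kn by simp
  have fin: "finite ?E" using finite_G rcosets_finite by (simp add: RCOSETS_def)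
  obtain m where m: "finite_p_group (G\<lparr>carrier := H\<rparr>) p m" using subgroup_p_group[OF H] by blast
  interpret P: finite_p_group "G\<lparr>carrier := H\<rparr>" p m by fact
  have coset: "R #> h \<in> ?E" if "R \<in> ?E" "h \<in> carrier G" for R h
    using that coset_mult_assoc[OF Hsub] by (auto simp: RCOSETS_def)
  \<comment> \<open>The inverse turns right multiplication into a left action.\<close>
  have act: "group_action (G\<lparr>carrier := H\<rparr>) ?E (\<lambda>h. \<lambda>R \<in> ?E. R #> inv h)"
  proof (rule P.group_actionI)
    fix g h R assume gh: "g \<in> carrier (G\<lparr>carrier := H\<rparr>)" "h \<in> carrier (G\<lparr>carrier := H\<rparr>)" "R \<in> ?E"
    have "R \<subseteq> carrier G" using gh(3) subgroup.rcosets_carrier[OF H] group_axioms by blast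
    then show "R #> inv (g \<otimes>\<^bsub>G\<lparr>carrier := H\<rparr>\<^esub> h) = R #> inv h #> inv g"
      using gh sub by (simp add: inv_mult_group coset_mult_assoc)
  next
    fix R assume "R \<in> ?E"
    then have "R \<subseteq> carrier G" using subgroup.rcosets_carrier[OF H] group_axioms by blast
    then show "R #> inv \<one>\<^bsub>G\<lparr>carrier := H\<rparr>\<^esub> = R" by simp
  qed (use coset sub in auto)
  let ?F = "{R \<in> ?E. \<forall>h \<in> carrier (G\<lparr>carrier := H\<rparr>). (\<lambda>R \<in> ?E. R #> inv h) R = R}"
  have "p dvd card ?F" by (rule P.card_fixed_points_dvd[OF act fin dvd])
  moreover have HF: "H \<in> ?F"
    using sub coset_join2[OF _ H] subgroup.m_inv_closed[OF H] subgroup.subgroup_in_rcosets[OF H group_axioms]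
    by auto
  ultimately have "?F \<noteq> {H}" using prime_p by (metis card.empty card.insert empty_iff finite.emptyI
        not_prime_unit One_nat_def)
  then obtain R where R: "R \<in> ?F" "R \<noteq> H" using HF by blast
  then obtain y where y: "y \<in> carrier G" "R = H #> y" by (auto simp: RCOSETS_def)
  have "y \<notin> H" using R y coset_join2[OF y(1) H] by blast
  moreover have "y \<otimes> h \<otimes> inv y \<in> H" if h: "h \<in> H" for h
  proof -
    have "R #> inv (inv h) = R" using R h subgroup.m_inv_closed[OF H h] by auto
    then have "H #> (y \<otimes> h) = H #> y" using y h sub coset_mult_assoc[OF Hsub] by simp
    then have "y \<otimes> h \<in> H #> y" using rcos_self[OF _ H, of "y \<otimes> h"] y h sub by simp
    then obtain k where "k \<in> H" "y \<otimes> h = k \<otimes> y" by (auto simp: r_coset_def)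
    then show ?thesis using y h sub by (simp add: m_assoc)
  qed
  ultimately show ?thesis using y by blast
qed

text \<open>Powers of a normalizing element still normalize \<open>H\<close>. In the sequence of
  iterated \<open>p\<close>-th powers of \<open>y\<close>, which ends in \<one>, the last term
  before the first one in \<open>H\<close> is as required.\<close>

lemma (in finite_p_group) ex_normalizing_element_pow:
  assumes H: "subgroup H G" and "H \<noteq> carrier G"
  shows "\<exists>y \<in> carrier G - H. y [^] p \<in> H \<and> (\<forall>h \<in> H. y \<otimes> h \<otimes> inv y \<in> H)"
proof -
  obtain y where y: "y \<in> carrier G" "y \<notin> H" "\<forall>h \<in> H. y \<otimes> h \<otimes> inv y \<in> H"
    using ex_normalizing_element[OF assms] by blast
  note sub = subgroup.mem_carrier[OF H]
  have conj: "\<forall>h \<in> H. y [^] i \<otimes> h \<otimes> inv (y [^] i) \<in> H" for i :: nat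
  proof (induction i)
    case 0 then show ?case using sub by simp
  next
    case (Suc i)
    show ?case
    proof
      fix h assume h: "h \<in> H"
      have "y [^] Suc i \<otimes> h \<otimes> inv (y [^] Suc i) = y [^] i \<otimes> (y \<otimes> h \<otimes> inv y) \<otimes> inv (y [^] i)"
        using y h sub by (simp add: inv_mult_group m_assoc)
      then show "y [^] Suc i \<otimes> h \<otimes> inv (y [^] Suc i) \<in> H" using Suc y h by simp
    qed
  qed
  define j where "j = (LEAST j. y [^] (p ^ j) \<in> H)"
  have "y [^] (p ^ n) \<in> H" using pow_order_eq_one y subgroup.one_closed[OF H] by simp
  then have j: "y [^] (p ^ j) \<in> H" unfolding j_def by (rule LeastI)
  have "j \<noteq> 0" using j y by (metis nat_pow_eone power_0)
  then obtain i where i: "j = Suc i" by (cases j) auto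
  have "y [^] (p ^ i) \<notin> H" using not_less_Least[of i "\<lambda>j. y [^] (p ^ j) \<in> H"] i j_def by simp
  moreover have "(y [^] (p ^ i)) [^] p \<in> H" using j i y by (simp add: nat_pow_pow mult.commute)
  ultimately show ?thesis using y conj by (intro bexI[of _ "y [^] (p ^ i)"]) auto
qed

section \<open>Extending homomorphisms by one generator\<close>

text \<open>In general only a set. Under the assumptions of \<open>normalizing_element\<close> below
  it is the subgroup generated by \<open>K\<close> and \<open>y\<close>; natural exponents suffice
  because a positive power of \<open>y\<close> lies in \<open>K\<close>.\<close>

definition adjoin :: "('a, 'b) monoid_scheme \<Rightarrow> 'a set \<Rightarrow> 'a \<Rightarrow> 'a set" where
  "adjoin G K y = {k \<otimes>\<^bsub>G\<^esub> y [^]\<^bsub>G\<^esub> (i::nat) | k i. k \<in> K}"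

lemma (in group) adjoin_subset:
  assumes "subgroup L G" "K \<subseteq> L" "y \<in> L"
  shows "adjoin G K y \<subseteq> L"
proof -
  have "y [^] i \<in> L" for i :: nat
    using assms(1,3) by (induction i) (auto simp: subgroup.one_closed subgroup.m_closed)
  then show ?thesis using assms by (auto simp: adjoin_def subgroup.m_closed)
qed

lemma (in group) subset_adjoin:
  assumes "subgroup K G" "y \<in> carrier G"
  shows "K \<subseteq> adjoin G K y"
proof
  fix k assume "k \<in> K"
  then have "k = k \<otimes> y [^] (0::nat)" using subgroup.mem_carrier[OF assms(1)] by simp
  then show "k \<in> adjoin G K y" using \<open>k \<in> K\<close> unfolding adjoin_def by blast
qed

lemma (in group) mem_adjoin:
  assumes "subgroup K G" "y \<in> carrier G"
  shows "y \<in> adjoin G K y"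
proof -
  have "y = \<one> \<otimes> y [^] (1::nat)" using assms by simp
  then show ?thesis using subgroup.one_closed[OF assms(1)] unfolding adjoin_def by blast
qed

locale normalizing_element = group G for G (structure) +
  fixes K y and p :: nat
  assumes K: "subgroup K G"
    and y: "y \<in> carrier G"
    and conj_closed: "\<And>k. k \<in> K \<Longrightarrow> y \<otimes> k \<otimes> inv y \<in> K"
    and pow_p: "y [^] p \<in> K"
    and p_pos: "0 < p"
begin

lemma K_carrier: "k \<in> K \<Longrightarrow> k \<in> carrier G"
  using subgroup.mem_carrier[OF K] .

lemma conj_pow_closed: "k \<in> K \<Longrightarrow> y [^] (i::nat) \<otimes> k \<otimes> inv (y [^] i) \<in> K"
proof (induction i arbitrary: k)
  case 0 then show ?case using K_carrier by simp
next
  case (Suc i)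
  have "y [^] Suc i \<otimes> k \<otimes> inv (y [^] Suc i) = y [^] i \<otimes> (y \<otimes> k \<otimes> inv y) \<otimes> inv (y [^] i)"
    using y Suc.prems K_carrier by (simp add: inv_mult_group m_assoc)
  then show ?case using Suc.IH[OF conj_closed[OF Suc.prems]] by simp
qed

text \<open>The normal form of a product: moving \<open>y [^] i\<close> past \<open>l\<close>
  replaces \<open>l\<close> by a conjugate, which stays in \<open>K\<close>.\<close>

lemma mult_eq:
  assumes "k \<in> K" "l \<in> K"
  shows "(k \<otimes> y [^] (i::nat)) \<otimes> (l \<otimes> y [^] (j::nat))
       = (k \<otimes> (y [^] i \<otimes> l \<otimes> inv (y [^] i))) \<otimes> y [^] (i + j)"
proof -
  have "inv (y [^] i) \<otimes> y [^] (i + j) = y [^] j"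
    using y by (simp add: nat_pow_mult[symmetric] m_assoc[symmetric])
  then show ?thesis using assms K_carrier y by (simp add: m_assoc)
qed

lemma pow_p_mult: "y [^] (p * i) \<in> K"
proof -
  have "(y [^] p) [^] i \<in> K"
    using pow_p K by (induction i) (auto simp: subgroup.one_closed subgroup.m_closed)
  then show ?thesis using y by (simp add: nat_pow_pow)
qed

lemma adjoin_subgroup: "subgroup (adjoin G K y) G"
proof (rule subgroupI)
  show "adjoin G K y \<subseteq> carrier G"
    by (rule adjoin_subset[OF subgroup_self]) (use K_carrier y in auto)
  show "adjoin G K y \<noteq> {}" using mem_adjoin[OF K y] by blast
next
  fix a b assume "a \<in> adjoin G K y" "b \<in> adjoin G K y"
  then obtain k i l j where "k \<in> K" "l \<in> K" "a = k \<otimes> y [^] (i::nat)" "b = l \<otimes> y [^] (j::nat)"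
    unfolding adjoin_def by blast
  moreover from this have "k \<otimes> (y [^] i \<otimes> l \<otimes> inv (y [^] i)) \<in> K"
    using conj_pow_closed subgroup.m_closed[OF K] by blast
  ultimately show "a \<otimes> b \<in> adjoin G K y"
    using mult_eq unfolding adjoin_def by blast
next
  fix a assume "a \<in> adjoin G K y"
  then obtain k i where k: "k \<in> K" "a = k \<otimes> y [^] (i::nat)"
    unfolding adjoin_def by blast
  \<comment> \<open>Chosen so that \<open>i + m\<close> is a multiple of \<open>p\<close>: the
    inverse of \<open>y [^] i\<close> is then \<open>y [^] m\<close> up to a factor in
    \<open>K\<close>.\<close>
  define m where "m = (p - 1) * i"
  have m: "i + m = p * i" using p_pos unfolding m_def by (cases p) auto
  define l where "l = inv (y [^] (p * i)) \<otimes> inv k"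
  have l: "l \<in> K" unfolding l_def
    using pow_p_mult k K by (simp add: subgroup.m_closed subgroup.m_inv_closed)
  have "inv (y [^] i) = y [^] m \<otimes> inv (y [^] (p * i))"
    using y by (simp add: m[symmetric] nat_pow_mult[symmetric] inv_mult_group m_assoc[symmetric])
  then have "inv a = y [^] m \<otimes> l"
    using k K_carrier y unfolding l_def by (simp add: inv_mult_group m_assoc)
  also have "\<dots> = (y [^] m \<otimes> l \<otimes> inv (y [^] m)) \<otimes> y [^] m"
    using y l K_carrier by (simp add: m_assoc)
  finally show "inv a \<in> adjoin G K y"
    using conj_pow_closed[OF l] unfolding adjoin_def by blast
qed

text \<open>Exponents of \<open>y\<close> can be reduced modulo \<open>p\<close>, the multiple of
  \<open>p\<close> being absorbed into \<open>K\<close>.\<close>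

lemma card_adjoin_le:
  assumes "finite K"
  shows "card (adjoin G K y) \<le> p * card K"
proof -
  have "adjoin G K y \<subseteq> (\<lambda>(i, k). k \<otimes> y [^] i) ` ({..<p} \<times> K)"
  proof
    fix x assume "x \<in> adjoin G K y"
    then obtain k i where k: "k \<in> K" "x = k \<otimes> y [^] (i::nat)" unfolding adjoin_def by blast
    have "x = k \<otimes> y [^] (p * (i div p) + i mod p)" using k by simp
    also have "\<dots> = (k \<otimes> y [^] (p * (i div p))) \<otimes> y [^] (i mod p)"
      using k(1) K_carrier y by (simp only: nat_pow_mult[symmetric]) (simp add: m_assoc)
    finally show "x \<in> (\<lambda>(i, k). k \<otimes> y [^] i) ` ({..<p} \<times> K)"
      using subgroup.m_closed[OF K k(1) pow_p_mult] p_pos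
      by (intro image_eqI[of _ _ "(i mod p, k \<otimes> y [^] (p * (i div p)))"]) auto
  qed
  then have "card (adjoin G K y) \<le> card ({..<p} \<times> K)"
    using assms by (meson finite_SigmaI finite_lessThan surj_card_le)
  then show ?thesis by (simp add: card_cartesian_product)
qed

text \<open>The extension sends \<open>k \<otimes> y [^] i\<close> to \<open>f k\<close> times the
  \<open>i\<close>-th power of \<open>c\<close>. It is well defined because \<open>y [^] i\<close>
  lies in \<open>K\<close> only for multiples \<open>i\<close> of \<open>p\<close>, where
  \<open>f\<close> agrees with the powers of \<open>c\<close>. It is multiplicative because
  \<open>f\<close> is invariant under conjugation by \<open>y\<close> and \<open>C\<close> is
  abelian.\<close>

lemma hom_extends_to_adjoin:
  assumes "comm_group C" and f: "f \<in> hom (G\<lparr>carrier := K\<rparr>) C"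
    and inv_f: "\<And>k. k \<in> K \<Longrightarrow> f (y \<otimes> k \<otimes> inv y) = f k"
    and c: "c \<in> carrier C" "c [^]\<^bsub>C\<^esub> p = f (y [^] p)"
    and p: "Factorial_Ring.prime p" and "y \<notin> K"
  obtains f' where "f' \<in> hom (G\<lparr>carrier := adjoin G K y\<rparr>) C"
    "\<And>k i. k \<in> K \<Longrightarrow> f' (k \<otimes> y [^] (i::nat)) = f k \<otimes>\<^bsub>C\<^esub> c [^]\<^bsub>C\<^esub> i"
proof -
  interpret C: comm_group C by fact
  have fC: "f k \<in> carrier C" if "k \<in> K" for k using f that by (auto simp: hom_def)
  have fm: "f (k \<otimes> l) = f k \<otimes>\<^bsub>C\<^esub> f l" if "k \<in> K" "l \<in> K" for k l
    using f that by (auto simp: hom_def)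
  \<comment> \<open>Otherwise Bezout gives \<open>i * s = p * t + 1\<close>, and \<open>y\<close>
    itself would lie in \<open>K\<close>.\<close>
  have dvd: "p dvd i" if i: "y [^] (i::nat) \<in> K" for i
  proof (rule ccontr)
    assume "\<not> p dvd i"
    then have "coprime p i" using p by (simp add: prime_imp_coprime)
    then have cp: "coprime i p" by (simp add: coprime_commute)
    have "i \<noteq> 0" using \<open>\<not> p dvd i\<close> by (metis dvd_0_right)
    then obtain s t where st: "i * s = p * t + 1"
      using bezout_nat[of i p] cp by auto
    have "(y [^] i) [^] s \<in> K"
      using i K by (induction s) (auto simp: subgroup.one_closed subgroup.m_closed)
    then have "y [^] (p * t + 1) \<in> K" using y st by (simp add: nat_pow_pow)
    then have 1: "y [^] (p * t) \<otimes> y \<in> K" using y by simp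
    have "y = inv (y [^] (p * t)) \<otimes> (y [^] (p * t) \<otimes> y)"
      using y by (simp add: m_assoc[symmetric])
    also have "\<dots> \<in> K" using 1 pow_p_mult K by (simp add: subgroup.m_closed subgroup.m_inv_closed)
    finally show False using \<open>y \<notin> K\<close> by blast
  qed
  have f_one: "f \<one> = \<one>\<^bsub>C\<^esub>"
    using fm[of \<one> \<one>] fC[of \<one>] subgroup.one_closed[OF K] C.r_cancel_one by fastforce
  have f_pow: "f (y [^] i) = c [^]\<^bsub>C\<^esub> i" if i: "y [^] (i::nat) \<in> K" for i
  proof -
    obtain q where q: "i = p * q" using dvd[OF i] by blast
    have "f (y [^] (p * q)) = c [^]\<^bsub>C\<^esub> (p * q)" for q
    proof (induction q)
      case (Suc q)
      have "y [^] (p * Suc q) = y [^] p \<otimes> y [^] (p * q)" using y by (simp add: nat_pow_mult)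
      then show ?case
        using Suc fm pow_p pow_p_mult c by (simp add: C.nat_pow_mult[symmetric])
    qed (simp add: f_one)
    then show ?thesis using q by simp
  qed
  have f_conj: "f (y [^] (i::nat) \<otimes> k \<otimes> inv (y [^] i)) = f k" if "k \<in> K" for i k
    using that
  proof (induction i arbitrary: k)
    case 0 then show ?case using K_carrier by simp
  next
    case (Suc i)
    have "y [^] Suc i \<otimes> k \<otimes> inv (y [^] Suc i) = y [^] i \<otimes> (y \<otimes> k \<otimes> inv y) \<otimes> inv (y [^] i)"
      using y Suc.prems K_carrier by (simp add: inv_mult_group m_assoc)
    then show ?case using Suc.IH[OF conj_closed[OF Suc.prems]] inv_f[OF Suc.prems] by simp
  qed
  \<comment> \<open>Of two representations of one element, take the one with the larger exponent
    first; the difference \<open>d\<close> of the exponents then satisfies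
    \<open>y [^] d \<in> K\<close>.\<close>
  have wd_le: "f k \<otimes>\<^bsub>C\<^esub> c [^]\<^bsub>C\<^esub> i = f l \<otimes>\<^bsub>C\<^esub> c [^]\<^bsub>C\<^esub> j"
    if kl: "k \<in> K" "l \<in> K" and eq: "k \<otimes> y [^] i = l \<otimes> y [^] j" and "j \<le> i" for k l and i j :: nat
  proof -
    obtain d where d: "i = d + j" using \<open>j \<le> i\<close> by (metis add.commute le_iff_add)
    have "k \<otimes> y [^] d \<otimes> y [^] j = l \<otimes> y [^] j"
      using eq d kl K_carrier y by (simp add: nat_pow_mult[symmetric] m_assoc)
    then have l: "k \<otimes> y [^] d = l" using kl K_carrier y by (simp add: r_cancel)
    then have "y [^] d = inv k \<otimes> l" using kl K_carrier y by (auto simp: m_assoc[symmetric])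
    then have dK: "y [^] d \<in> K" using kl K by (simp add: subgroup.m_closed subgroup.m_inv_closed)
    have "f l = f k \<otimes>\<^bsub>C\<^esub> c [^]\<^bsub>C\<^esub> d" using fm[OF kl(1) dK] f_pow[OF dK] l by simp
    then show ?thesis using d kl fC c by (simp add: C.nat_pow_mult[symmetric] C.m_assoc)
  qed
  have wd: "f k \<otimes>\<^bsub>C\<^esub> c [^]\<^bsub>C\<^esub> i = f l \<otimes>\<^bsub>C\<^esub> c [^]\<^bsub>C\<^esub> j"
    if "k \<in> K" "l \<in> K" "k \<otimes> y [^] i = l \<otimes> y [^] j" for k l and i j :: nat
    using wd_le that by (metis nat_le_linear)
  define f' where "f' x = (SOME v. \<exists>k \<in> K. \<exists>i::nat. x = k \<otimes> y [^] i \<and> v = f k \<otimes>\<^bsub>C\<^esub> c [^]\<^bsub>C\<^esub> i)" for x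
  have f': "f' (k \<otimes> y [^] i) = f k \<otimes>\<^bsub>C\<^esub> c [^]\<^bsub>C\<^esub> i" if k: "k \<in> K" for k and i :: nat
    unfolding f'_def by (rule some_equality) (use k wd[OF k] in \<open>metis\<close>)+
  have "f' \<in> hom (G\<lparr>carrier := adjoin G K y\<rparr>) C"
  proof (rule homI)
    fix x assume "x \<in> carrier (G\<lparr>carrier := adjoin G K y\<rparr>)"
    then obtain k i where "k \<in> K" "x = k \<otimes> y [^] (i::nat)" by (auto simp: adjoin_def)
    then show "f' x \<in> carrier C" using f' fC c by simp
  next
    fix x z assume "x \<in> carrier (G\<lparr>carrier := adjoin G K y\<rparr>)" "z \<in> carrier (G\<lparr>carrier := adjoin G K y\<rparr>)"
    then obtain k i l j where kl: "k \<in> K" "l \<in> K"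
      and x: "x = k \<otimes> y [^] (i::nat)" and z: "z = l \<otimes> y [^] (j::nat)"
      by (auto simp: adjoin_def)
    have "f' (x \<otimes> z) = f (k \<otimes> (y [^] i \<otimes> l \<otimes> inv (y [^] i))) \<otimes>\<^bsub>C\<^esub> c [^]\<^bsub>C\<^esub> (i + j)"
      using f' mult_eq[OF kl] kl conj_pow_closed subgroup.m_closed[OF K] x z by simp
    also have "\<dots> = f k \<otimes>\<^bsub>C\<^esub> f l \<otimes>\<^bsub>C\<^esub> (c [^]\<^bsub>C\<^esub> i \<otimes>\<^bsub>C\<^esub> c [^]\<^bsub>C\<^esub> j)"
      using fm kl conj_pow_closed f_conj c by (simp add: C.nat_pow_mult)
    also have "\<dots> = f' x \<otimes>\<^bsub>C\<^esub> f' z"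
      using f' x z kl fC c by (simp add: C.m_ac)
    finally show "f' (x \<otimes>\<^bsub>G\<lparr>carrier := adjoin G K y\<rparr>\<^esub> z) = f' x \<otimes>\<^bsub>C\<^esub> f' z" by simp
  qed
  then show thesis using f' by (rule that)
qed

end

text \<open>Enlarge \<open>H\<close> to a maximal proper subgroup \<open>M\<close>. A normalizing
  element \<open>y\<close> outside \<open>M\<close> with \<open>y [^] p\<close> in \<open>M\<close>
  generates \<open>G\<close> together with \<open>M\<close>, so the trivial homomorphism on
  \<open>M\<close> extends to \<open>G\<close> with \<open>y\<close> sent to
  \<open>c\<close>.\<close>

lemma (in finite_p_group) ex_hom_trivial_on_subgroup:
  assumes C: "comm_group C" and H: "subgroup H G" and "H \<noteq> carrier G"
    and c: "c \<in> carrier C" "c [^]\<^bsub>C\<^esub> p = \<one>\<^bsub>C\<^esub>"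
  obtains f y where "f \<in> hom G C" "\<And>h. h \<in> H \<Longrightarrow> f h = \<one>\<^bsub>C\<^esub>" "y \<in> carrier G" "f y = c"
    "\<And>x. x \<in> carrier G \<Longrightarrow> \<exists>i::nat. f x = c [^]\<^bsub>C\<^esub> i"
proof -
  interpret C: comm_group C by fact
  let ?S = "{M. subgroup M G \<and> H \<subseteq> M \<and> M \<noteq> carrier G}"
  have "finite ?S" using finite_G subgroup.subset
    by (intro finite_subset[of ?S "Pow (carrier G)"]) auto
  moreover have "H \<in> ?S" using assms by blast
  ultimately obtain M where M: "M \<in> ?S" "\<And>N. N \<in> ?S \<Longrightarrow> M \<subseteq> N \<Longrightarrow> N = M"
    using finite_has_maximal[of ?S] by (metis (no_types, lifting) empty_iff)
  then have Ms: "subgroup M G" "H \<subseteq> M" "M \<noteq> carrier G" by auto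
  obtain y where y: "y \<in> carrier G" "y \<notin> M" "y [^] p \<in> M" "\<And>h. h \<in> M \<Longrightarrow> y \<otimes> h \<otimes> inv y \<in> M"
    using ex_normalizing_element_pow[OF Ms(1,3)] by blast
  interpret N: normalizing_element G M y p
    using Ms(1) y prime_gt_0_nat[OF prime_p]
    by (simp add: normalizing_element_def normalizing_element_axioms_def group_axioms)
  have sub: "M \<subseteq> adjoin G M y" "y \<in> adjoin G M y"
    using subset_adjoin[OF Ms(1) y(1)] mem_adjoin[OF Ms(1) y(1)] .
  have eq: "adjoin G M y = carrier G"
    using M(2)[of "adjoin G M y"] N.adjoin_subgroup sub Ms(2) y(2) by blast
  have triv: "(\<lambda>_. \<one>\<^bsub>C\<^esub>) \<in> hom (G\<lparr>carrier := M\<rparr>) C" by (auto simp: hom_def)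
  obtain f where f: "f \<in> hom (G\<lparr>carrier := adjoin G M y\<rparr>) C"
    "\<And>k i. k \<in> M \<Longrightarrow> f (k \<otimes> y [^] (i::nat)) = \<one>\<^bsub>C\<^esub> \<otimes>\<^bsub>C\<^esub> c [^]\<^bsub>C\<^esub> i"
    by (rule N.hom_extends_to_adjoin[OF C triv _ c(1)]) (use c prime_p y in auto)
  show thesis
  proof (rule that[of f y])
    show "f \<in> hom G C" using f(1) eq by simp
    show "f h = \<one>\<^bsub>C\<^esub>" if "h \<in> H" for h
      using f(2)[of h 0] that Ms N.K_carrier by auto
    show "y \<in> carrier G" by fact
    show "f y = c" using f(2)[of \<one> 1] subgroup.one_closed[OF Ms(1)] y c by simp
    show "\<exists>i::nat. f x = c [^]\<^bsub>C\<^esub> i" if x: "x \<in> carrier G" for x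
    proof -
      obtain k i where "k \<in> M" "x = k \<otimes> y [^] (i::nat)"
        using x eq unfolding adjoin_def by blast
      then show ?thesis using f(2) c by (intro exI[of _ i]) simp
    qed
  qed
qed

section \<open>Commutators and the center modulo a central subgroup\<close>

text \<open>With this convention conjugation by \<open>g\<close> is left multiplication by
  \<open>commutator G g x\<close>. The commutators in \<open>comm_subgroup\<close> are of the form
  \<open>inv h \<otimes> inv k \<otimes> h \<otimes> k\<close> instead.\<close>

definition commutator :: "('a, 'b) monoid_scheme \<Rightarrow> 'a \<Rightarrow> 'a \<Rightarrow> 'a" where
  "commutator G g x = g \<otimes>\<^bsub>G\<^esub> x \<otimes>\<^bsub>G\<^esub> inv\<^bsub>G\<^esub> g \<otimes>\<^bsub>G\<^esub> inv\<^bsub>G\<^esub> x"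

text \<open>For normal \<open>N\<close> this is the preimage of the center of \<open>G/N\<close>;
  for \<open>N = grp_center G\<close> it is the second center.\<close>

definition center_mod :: "('a, 'b) monoid_scheme \<Rightarrow> 'a set \<Rightarrow> 'a set" where
  "center_mod G N = {g \<in> carrier G. \<forall>x \<in> carrier G. commutator G g x \<in> N}"

context group
begin

lemma inv_mult_cancel:
  "x \<in> carrier G \<Longrightarrow> y \<in> carrier G \<Longrightarrow> inv x \<otimes> (x \<otimes> y) = y"
  "x \<in> carrier G \<Longrightarrow> y \<in> carrier G \<Longrightarrow> x \<otimes> (inv x \<otimes> y) = y"
  by (simp_all add: m_assoc[symmetric])

lemma centerD: "z \<in> grp_center G \<Longrightarrow> x \<in> carrier G \<Longrightarrow> x \<otimes> z = z \<otimes> x"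
  by (simp add: grp_center_def)

lemma centerI:
  "z \<in> carrier G \<Longrightarrow> (\<And>x. x \<in> carrier G \<Longrightarrow> x \<otimes> z = z \<otimes> x) \<Longrightarrow> z \<in> grp_center G"
  unfolding grp_center_def by blast

lemma center_carrier: "z \<in> grp_center G \<Longrightarrow> z \<in> carrier G"
  by (simp add: grp_center_def)

lemma center_subgroup: "subgroup (grp_center G) G"
proof (rule subgroupI)
  fix z assume z: "z \<in> grp_center G"
  show "inv z \<in> grp_center G"
  proof (rule centerI)
    fix x assume x: "x \<in> carrier G"
    have "inv (inv x \<otimes> z) = inv (z \<otimes> inv x)" using centerD[OF z, of "inv x"] x by simp
    then show "x \<otimes> inv z = inv z \<otimes> x"
      using x center_carrier[OF z] by (simp add: inv_mult_group)
  qed (use center_carrier[OF z] in simp)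
next
  fix y z assume yz: "y \<in> grp_center G" "z \<in> grp_center G"
  note c = center_carrier[OF yz(1)] center_carrier[OF yz(2)]
  show "y \<otimes> z \<in> grp_center G"
  proof (rule centerI)
    fix x assume x: "x \<in> carrier G"
    have "x \<otimes> (y \<otimes> z) = y \<otimes> (x \<otimes> z)"
      using centerD[OF yz(1) x] x c by (simp add: m_assoc[symmetric])
    also have "\<dots> = y \<otimes> z \<otimes> x"
      unfolding centerD[OF yz(2) x] using x c by (simp add: m_assoc)
    finally show "x \<otimes> (y \<otimes> z) = y \<otimes> z \<otimes> x" .
  qed (use c in simp)
next
  have "\<one> \<in> grp_center G" by (simp add: grp_center_def)
  then show "grp_center G \<noteq> {}" by blast
qed (auto simp: grp_center_def)

lemma center_comm_group: "comm_group (G\<lparr>carrier := grp_center G\<rparr>)"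
proof (rule group.group_comm_groupI[OF subgroup_imp_group[OF center_subgroup]])
  fix x y assume "x \<in> carrier (G\<lparr>carrier := grp_center G\<rparr>)" "y \<in> carrier (G\<lparr>carrier := grp_center G\<rparr>)"
  then show "x \<otimes>\<^bsub>G\<lparr>carrier := grp_center G\<rparr>\<^esub> y = y \<otimes>\<^bsub>G\<lparr>carrier := grp_center G\<rparr>\<^esub> x"
    using centerD[of y x] center_carrier[of x] by simp
qed

lemma commutator_closed [simp]:
  "g \<in> carrier G \<Longrightarrow> x \<in> carrier G \<Longrightarrow> commutator G g x \<in> carrier G"
  by (simp add: commutator_def)

lemma conj_eq_commutator:
  "g \<in> carrier G \<Longrightarrow> x \<in> carrier G \<Longrightarrow> g \<otimes> x \<otimes> inv g = commutator G g x \<otimes> x"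
  by (simp add: commutator_def m_assoc)

lemma commutator_eq_one_iff:
  assumes "g \<in> carrier G" "x \<in> carrier G"
  shows "commutator G g x = \<one> \<longleftrightarrow> g \<otimes> x = x \<otimes> g"
  using assms unfolding commutator_def
  by (metis inv_closed inv_solve_right' l_one m_closed one_closed)

lemma commutator_center_left:
  "z \<in> grp_center G \<Longrightarrow> x \<in> carrier G \<Longrightarrow> commutator G z x = \<one>"
  using commutator_eq_one_iff[of z x] centerD[of z x] center_carrier by simp

lemma inv_commutator:
  assumes "g \<in> carrier G" "x \<in> carrier G"
  shows "inv (commutator G g x) = commutator G x g"
  using assms by (simp add: commutator_def inv_mult_group m_assoc)

text \<open>In general [gh, x] = g [h, x] g^-1 [g, x]; a central [h, x] is unaffected by the
  conjugation and commutes with the other factor.\<close>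

lemma commutator_mult_left:
  assumes "g \<in> carrier G" "h \<in> carrier G" "x \<in> carrier G" "commutator G h x \<in> grp_center G"
  shows "commutator G (g \<otimes> h) x = commutator G g x \<otimes> commutator G h x"
proof -
  have "commutator G (g \<otimes> h) x = g \<otimes> (h \<otimes> x \<otimes> inv h) \<otimes> inv g \<otimes> inv x"
    using assms by (simp add: commutator_def inv_mult_group m_assoc)
  also have "\<dots> = (g \<otimes> commutator G h x) \<otimes> (x \<otimes> inv g \<otimes> inv x)"
    unfolding conj_eq_commutator[OF assms(2,3)] using assms by (simp add: m_assoc)
  also have "\<dots> = commutator G h x \<otimes> commutator G g x"
    unfolding centerD[OF assms(4,1)]
    using assms(1,3) commutator_closed[OF assms(2,3)] by (simp add: commutator_def[of G g x] m_assoc)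
  also have "\<dots> = commutator G g x \<otimes> commutator G h x"
    using centerD[OF assms(4), of "commutator G g x"] assms by simp
  finally show ?thesis .
qed

lemma commutator_mult_right:
  assumes "g \<in> carrier G" "x \<in> carrier G" "y \<in> carrier G" "commutator G g y \<in> grp_center G"
  shows "commutator G g (x \<otimes> y) = commutator G g x \<otimes> commutator G g y"
proof -
  have "commutator G g (x \<otimes> y) = g \<otimes> x \<otimes> inv g \<otimes> (g \<otimes> y \<otimes> inv g \<otimes> inv y) \<otimes> inv x"
    using assms by (simp add: commutator_def inv_mult_group m_assoc inv_mult_cancel)
  also have "\<dots> = g \<otimes> x \<otimes> inv g \<otimes> (commutator G g y \<otimes> inv x)"
    using assms by (simp add: commutator_def m_assoc)
  also have "\<dots> = g \<otimes> x \<otimes> inv g \<otimes> (inv x \<otimes> commutator G g y)"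
    using centerD[OF assms(4), of "inv x"] assms(2) by simp
  also have "\<dots> = commutator G g x \<otimes> commutator G g y"
    using assms commutator_closed[OF assms(1,3)] by (simp add: commutator_def[of G g x] m_assoc)
  finally show ?thesis .
qed

lemma center_mod_subgroup:
  assumes N: "subgroup N G" and sub: "N \<subseteq> grp_center G"
  shows "subgroup (center_mod G N) G"
proof (rule subgroupI)
  fix g assume g: "g \<in> center_mod G N"
  have "commutator G (inv g) x \<in> N" if x: "x \<in> carrier G" for x
  proof -
    have c: "commutator G g x \<in> N" and gc: "g \<in> carrier G" using g x by (auto simp: center_mod_def)
    then have "commutator G (inv g) x \<otimes> commutator G g x = commutator G (inv g \<otimes> g) x"
      using commutator_mult_left[of "inv g" g x] x sub by auto
    also have "\<dots> = \<one>" using gc x by (simp add: commutator_def)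
    finally have "commutator G (inv g) x = inv (commutator G g x)"
      using gc x by (simp add: inv_equality)
    then show ?thesis using c subgroup.m_inv_closed[OF N] by simp
  qed
  then show "inv g \<in> center_mod G N" using g by (simp add: center_mod_def)
next
  fix g h assume "g \<in> center_mod G N" "h \<in> center_mod G N"
  then show "g \<otimes> h \<in> center_mod G N"
    using commutator_mult_left[of g h] sub subgroup.m_closed[OF N]
    by (auto simp: center_mod_def)
next
  have "\<one> \<in> center_mod G N" using subgroup.one_closed[OF N] by (simp add: center_mod_def commutator_def)
  then show "center_mod G N \<noteq> {}" by blast
qed (auto simp: center_mod_def)

lemma center_subset_center_mod: "subgroup N G \<Longrightarrow> grp_center G \<subseteq> center_mod G N"
  by (auto simp: center_mod_def center_carrier commutator_center_left subgroup.one_closed)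

lemma commutator_pow_left:
  assumes "u \<in> center_mod G (grp_center G)" "x \<in> carrier G"
  shows "commutator G (u [^] (i::nat)) x = commutator G u x [^] i"
proof (induction i)
  case 0 then show ?case using assms by (simp add: commutator_def)
next
  case (Suc i)
  then show ?case using assms commutator_mult_left[of "u [^] i" u x] by (simp add: center_mod_def)
qed

text \<open>This is the preimage of the centralizer of the image of \<open>a\<close> in the quotient
  by the center.\<close>

lemma commutator_centralizer_subgroup:
  assumes a: "a \<in> carrier G"
  shows "subgroup {x \<in> carrier G. commutator G a x \<in> grp_center G} G" (is "subgroup ?L G")
proof (rule subgroupI)
  fix x assume x: "x \<in> ?L"
  have "commutator G a (inv x) \<otimes> commutator G a x = commutator G a (inv x \<otimes> x)"
    using commutator_mult_right[of a "inv x" x] x a by simp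
  also have "\<dots> = \<one>" using a x by (simp add: commutator_def)
  finally have "commutator G a (inv x) = inv (commutator G a x)"
    using a x by (simp add: inv_equality)
  then show "inv x \<in> ?L" using x subgroup.m_inv_closed[OF center_subgroup] by simp
next
  fix x y assume "x \<in> ?L" "y \<in> ?L"
  then show "x \<otimes> y \<in> ?L"
    using commutator_mult_right[of a x y] a subgroup.m_closed[OF center_subgroup] by simp
next
  have "\<one> \<in> ?L" using a subgroup.one_closed[OF center_subgroup] by (simp add: commutator_def)
  then show "?L \<noteq> {}" by blast
qed auto

lemma centralizer_subgroup:
  assumes "S \<subseteq> carrier G"
  shows "subgroup {g \<in> carrier G. \<forall>v \<in> S. g \<otimes> v = v \<otimes> g} G" (is "subgroup ?L G")
proof (rule subgroupI)
  fix g assume g: "g \<in> ?L"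
  have "inv g \<otimes> v = v \<otimes> inv g" if "v \<in> S" for v
  proof -
    have v: "v \<in> carrier G" "g \<otimes> v = v \<otimes> g" using that assms g by auto
    have "inv g \<otimes> v = inv g \<otimes> (v \<otimes> g) \<otimes> inv g" using g v(1) by (simp add: m_assoc)
    also have "\<dots> = v \<otimes> inv g" using g v(1) by (simp add: v(2)[symmetric] inv_mult_cancel)
    finally show ?thesis .
  qed
  then show "inv g \<in> ?L" using g by simp
next
  fix g h assume gh: "g \<in> ?L" "h \<in> ?L"
  have "g \<otimes> h \<otimes> v = v \<otimes> (g \<otimes> h)" if "v \<in> S" for v
  proof -
    have v: "v \<in> carrier G" "g \<otimes> v = v \<otimes> g" "h \<otimes> v = v \<otimes> h" using gh that assms by auto
    have "g \<otimes> h \<otimes> v = g \<otimes> v \<otimes> h" using gh v(1,3) by (simp add: m_assoc)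
    also have "\<dots> = v \<otimes> (g \<otimes> h)" unfolding v(2) using gh v(1) by (simp add: m_assoc)
    finally show ?thesis .
  qed
  then show "g \<otimes> h \<in> ?L" using gh by simp
next
  have "\<one> \<in> ?L" using assms by auto
  then show "?L \<noteq> {}" by blast
qed auto

end

section \<open>Homomorphisms into the center\<close>

text \<open>The core of the proof, with the condition on automorphisms replaced by its consequence
  \<open>inner\<close> for homomorphisms into the center.\<close>

lemma (in finite_p_group) hom_to_center_not_all_inner:
  assumes n: "n \<le> 6" and card_Z: "p ^ 2 \<le> card (grp_center G)"
    and Z2_ne: "center_mod G (grp_center G) \<noteq> carrier G"
    and inner: "\<And>f. f \<in> hom G (G\<lparr>carrier := grp_center G\<rparr>) \<Longrightarrow> (\<And>z. z \<in> grp_center G \<Longrightarrow> f z = \<one>)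
      \<Longrightarrow> \<exists>u \<in> carrier G. \<forall>x \<in> carrier G. commutator G u x = f x"
  shows False
proof -

  \<comment> \<open>The center, the second center and a central subgroup of order p\<close>
  define Z where "Z = grp_center G"
  define Z2 where "Z2 = center_mod G Z"
  define C where "C = G\<lparr>carrier := Z\<rparr>"
  have Z: "subgroup Z G" unfolding Z_def by (rule center_subgroup)
  have Z2: "subgroup Z2 G" unfolding Z2_def using center_mod_subgroup[OF Z] Z_def by simp
  have ZZ2: "Z \<subseteq> Z2" unfolding Z2_def using center_subset_center_mod[OF Z] Z_def by simp
  note Zc = subgroup.mem_carrier[OF Z] and Z2c = subgroup.mem_carrier[OF Z2]
  have Z2D: "commutator G u x \<in> Z" "commutator G x u \<in> Z" if "u \<in> Z2" "x \<in> carrier G" for u x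
  proof -
    show 1: "commutator G u x \<in> Z" using that by (simp add: Z2_def center_mod_def)
    show "commutator G x u \<in> Z"
      using subgroup.m_inv_closed[OF Z 1] inv_commutator that Z2c by simp
  qed
  have C: "comm_group C" unfolding C_def Z_def by (rule center_comm_group)
  interpret C: comm_group C by fact
  have Cs [simp]: "carrier C = Z" "(\<otimes>\<^bsub>C\<^esub>) = (\<otimes>)" "\<one>\<^bsub>C\<^esub> = \<one>" by (simp_all add: C_def)
  have powC: "z [^]\<^bsub>C\<^esub> i = z [^] i" for z and i :: nat
    unfolding C_def by (rule nat_pow_consistent[symmetric])
  have p0: "0 < p" "1 < p" using prime_p prime_gt_0_nat prime_gt_1_nat by auto

  \<comment> \<open>An element of order \<open>p\<close> in the center: a nontrivial element of
    \<open>Z\<close> whose \<open>p\<close>-th power falls into the trivial subgroup.\<close>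
  obtain z0 where z0: "z0 \<in> Z" "z0 \<noteq> \<one>" "z0 [^] p = \<one>"
  proof -
    obtain m where "finite_p_group C p m" unfolding C_def using subgroup_p_group[OF Z] by blast
    then interpret P: finite_p_group C p m .
    have "card Z \<noteq> 1" using card_Z p0 unfolding Z_def by (metis one_less_power leD zero_less_numeral)
    then have "{\<one>\<^bsub>C\<^esub>} \<noteq> carrier C" by auto
    from P.ex_normalizing_element_pow[OF C.triv_subgroup this] show thesis
      using that by (auto simp: powC)
  qed
  have normalizing: "normalizing_element G K y p"
    if "subgroup K G" "y \<in> carrier G" "\<And>k. k \<in> K \<Longrightarrow> commutator G y k \<in> K" "y [^] p \<in> K" for K y
  proof -
    have "y \<otimes> k \<otimes> inv y \<in> K" if "k \<in> K" for k
      using that \<open>\<And>k. k \<in> K \<Longrightarrow> commutator G y k \<in> K\<close> \<open>y \<in> carrier G\<close>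
        \<open>subgroup K G\<close> conj_eq_commutator subgroup.mem_carrier[OF \<open>subgroup K G\<close>]
        subgroup.m_closed[OF \<open>subgroup K G\<close>] by simp
    then show ?thesis
      using that p0 by (simp add: normalizing_element_def normalizing_element_axioms_def group_axioms)
  qed
  have powers: "subgroup (adjoin G {\<one>} z) G \<and> card (adjoin G {\<one>} z) \<le> p"
    if "z \<in> carrier G" "z [^] p = \<one>" for z
  proof -
    interpret N: normalizing_element G "{\<one>}" z p
      by (rule normalizing) (use that triv_subgroup in \<open>auto simp: commutator_def\<close>)
    show ?thesis using N.adjoin_subgroup N.card_adjoin_le by simp
  qed
  define P where "P = adjoin G {\<one>} z0"
  have P: "subgroup P G" "card P \<le> p" using powers[of z0] z0 Zc unfolding P_def by auto
  have PZ: "P \<subseteq> Z" unfolding P_def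
    by (rule adjoin_subset[OF Z]) (use z0 subgroup.one_closed[OF Z] in auto)
  have z0_pow: "z0 [^] i \<in> P" for i :: nat
  proof -
    have "z0 [^] i = \<one> \<otimes> z0 [^] i" using Zc z0 by simp
    then show ?thesis unfolding P_def adjoin_def by blast
  qed
  have P_pow: "v [^] p = \<one>" if v: "v \<in> P" for v
  proof -
    obtain i :: nat where "v = z0 [^] i" using v z0 Zc unfolding P_def adjoin_def by auto
    then have "v [^] p = (z0 [^] p) [^] i" using z0(1) Zc by (simp add: nat_pow_pow mult.commute)
    then show ?thesis using z0 by simp
  qed
  \<comment> \<open>The values of \<open>f\<close> are central, which is what puts \<open>u\<close>
    into the second center.\<close>
  have inner': "\<exists>u \<in> Z2. \<forall>x \<in> carrier G. commutator G u x = f x"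
    if f: "f \<in> hom G C" "\<And>z. z \<in> Z \<Longrightarrow> f z = \<one>" for f
  proof -
    obtain u where u: "u \<in> carrier G" "\<And>x. x \<in> carrier G \<Longrightarrow> commutator G u x = f x"
      using inner[of f] f unfolding C_def Z_def by blast
    moreover have "f x \<in> Z" if "x \<in> carrier G" for x using f(1) that by (auto simp: hom_def)
    ultimately have "u \<in> Z2" unfolding Z2_def center_mod_def by simp
    with u show ?thesis by blast
  qed
  have ghom: "group_hom G C f" if "f \<in> hom G C" for f
    using that group_axioms C.group_axioms by (simp add: group_hom_def group_hom_axioms_def)

  \<comment> \<open>Two homomorphisms with different kernels\<close>
  obtain f1 a where f1: "f1 \<in> hom G C" "\<And>h. h \<in> Z2 \<Longrightarrow> f1 h = \<one>" "a \<in> carrier G" "f1 a = z0"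
    "\<And>x. x \<in> carrier G \<Longrightarrow> f1 x \<in> P"
  proof -
    obtain f y where "f \<in> hom G C" "\<And>h. h \<in> Z2 \<Longrightarrow> f h = \<one>\<^bsub>C\<^esub>" "y \<in> carrier G" "f y = z0"
      "\<And>x. x \<in> carrier G \<Longrightarrow> \<exists>i::nat. f x = z0 [^]\<^bsub>C\<^esub> i"
      by (rule ex_hom_trivial_on_subgroup[OF C Z2, of z0]) (use Z2_ne z0 Z_def Z2_def powC in auto)
    then show thesis using that[of f y] z0_pow powC by (metis Cs(3))
  qed
  have a_Z2: "a \<notin> Z2" using f1 z0 by metis
  \<comment> \<open>\<open>L\<close> contains \<open>Z2\<close> and \<open>a\<close>; it is proper because \<open>a \<notin> Z2\<close>, i.e. because \<open>G/Z2\<close> is not cyclic.\<close>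
  define L where "L = {x \<in> carrier G. commutator G a x \<in> Z}"
  have L: "subgroup L G" unfolding L_def Z_def by (rule commutator_centralizer_subgroup) fact
  have L_ne: "L \<noteq> carrier G"
  proof
    assume "L = carrier G"
    then have "a \<in> Z2" using f1(3) unfolding L_def Z2_def center_mod_def by blast
    then show False using a_Z2 by simp
  qed
  have aL: "a \<in> L" unfolding L_def using f1(3) subgroup.one_closed[OF Z]
    by (simp add: commutator_def m_assoc inv_mult_cancel)
  have Z2L: "Z2 \<subseteq> L" unfolding L_def using Z2D(2) f1(3) Z2c by blast
  obtain f2 b where f2: "f2 \<in> hom G C" "\<And>h. h \<in> L \<Longrightarrow> f2 h = \<one>" "b \<in> carrier G" "f2 b = z0"
    "\<And>x. x \<in> carrier G \<Longrightarrow> f2 x \<in> P"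
  proof -
    obtain f y where "f \<in> hom G C" "\<And>h. h \<in> L \<Longrightarrow> f h = \<one>\<^bsub>C\<^esub>" "y \<in> carrier G" "f y = z0"
      "\<And>x. x \<in> carrier G \<Longrightarrow> \<exists>i::nat. f x = z0 [^]\<^bsub>C\<^esub> i"
      by (rule ex_hom_trivial_on_subgroup[OF C L, of z0]) (use L_ne z0 powC in auto)
    then show thesis using that[of f y] z0_pow powC by (metis Cs(3))
  qed
  interpret f1: group_hom G C f1 by (rule ghom) fact
  interpret f2: group_hom G C f2 by (rule ghom) fact
  obtain u1 where u1: "u1 \<in> Z2" "\<And>x. x \<in> carrier G \<Longrightarrow> commutator G u1 x = f1 x"
    using inner'[of f1] f1 ZZ2 by blast
  obtain u2 where u2: "u2 \<in> Z2" "\<And>x. x \<in> carrier G \<Longrightarrow> commutator G u2 x = f2 x"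
    using inner'[of f2] f2 ZZ2 Z2L by blast

  \<comment> \<open>A chain of subgroups between Z and Z2\<close>
  have pow_Z: "u [^] p \<in> Z"
    if u: "u \<in> Z2" and uP: "\<And>x. x \<in> carrier G \<Longrightarrow> commutator G u x \<in> P" for u
  proof -
    \<comment> \<open>On the second center the commutator is multiplicative in its left argument,
      and \<open>P\<close> has exponent \<open>p\<close>.\<close>
    have "commutator G (u [^] p) x = \<one>" if "x \<in> carrier G" for x
      using commutator_pow_left[of u x p] u uP[OF that] that P_pow unfolding Z2_def Z_def by simp
    then have "x \<otimes> u [^] p = u [^] p \<otimes> x" if "x \<in> carrier G" for x
      using commutator_eq_one_iff[of "u [^] p" x] that u Z2c by simp
    then show ?thesis unfolding Z_def using u Z2c by (intro centerI) auto
  qed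
  define A1 where "A1 = adjoin G Z u2"
  interpret N1: normalizing_element G Z u2 p
  proof (rule normalizing[OF Z])
    show "u2 [^] p \<in> Z" by (rule pow_Z) (use u2 f2 in auto)
    show "commutator G u2 k \<in> Z" if "k \<in> Z" for k using Z2D u2 Zc that by blast
  qed (use u2 Z2c in auto)
  have A1: "subgroup A1 G" "Z \<subseteq> A1" "u2 \<in> A1"
    unfolding A1_def using N1.adjoin_subgroup subset_adjoin[OF Z] mem_adjoin[OF Z] u2 Z2c by auto
  define A2 where "A2 = adjoin G A1 u1"
  interpret N2: normalizing_element G A1 u1 p
  proof (rule normalizing[OF A1(1)])
    show "u1 [^] p \<in> A1" using pow_Z[of u1] u1 f1 A1 by auto
    show "commutator G u1 k \<in> A1" if "k \<in> A1" for k
      using Z2D u1 A1 that subgroup.mem_carrier[OF A1(1)] by blast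
  qed (use u1 Z2c in auto)
  have A2: "subgroup A2 G" "A1 \<subseteq> A2" "u1 \<in> A2"
    unfolding A2_def using N2.adjoin_subgroup subset_adjoin[OF A1(1)] mem_adjoin[OF A1(1)] u1 Z2c by auto
  have A1_sub: "A1 \<subseteq> T" if "subgroup T G" "Z \<subseteq> T" "u2 \<in> T" for T
    unfolding A1_def by (rule adjoin_subset) fact+
  have A2_sub: "A2 \<subseteq> T" if "subgroup T G" "Z \<subseteq> T" "u2 \<in> T" "u1 \<in> T" for T
    unfolding A2_def by (rule adjoin_subset) (use that A1_sub in auto)
  have "u2 \<notin> Z"
  proof
    assume "u2 \<in> Z"
    then have "f2 b = \<one>" using u2(2)[OF f2(3)] commutator_center_left f2(3) unfolding Z_def by simp
    then show False using f2 z0 by simp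
  qed
  then have card1: "p * card Z \<le> card A1"
    using A1 by (intro psubgroup_card_ge[OF Z]) auto
  \<comment> \<open>Here \<open>f2\<close> being trivial on \<open>L\<close> matters:
    \<open>f2 a = \<one>\<close>, so \<open>a\<close> commutes with \<open>u2\<close> and hence with
    all of \<open>A1\<close>, whereas its commutator with \<open>u1\<close> is
    \<open>f1 a = z0\<close>.\<close>
  have "u1 \<notin> A1"
  proof
    assume u1A: "u1 \<in> A1"
    let ?T = "{g \<in> carrier G. \<forall>v \<in> {a}. g \<otimes> v = v \<otimes> g}"
    have "A1 \<subseteq> ?T"
    proof (rule A1_sub)
      show "subgroup ?T G" by (rule centralizer_subgroup) (use f1 in simp)
      show "Z \<subseteq> ?T" using centerD[OF _ f1(3)] center_carrier unfolding Z_def by auto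
      show "u2 \<in> ?T"
        using u2(2)[OF f1(3)] f2(2)[OF aL] commutator_eq_one_iff[of u2 a] u2(1) Z2c f1(3) by simp
    qed
    then have "commutator G u1 a = \<one>"
      using u1A commutator_eq_one_iff[of u1 a] u1(1) Z2c f1(3) by auto
    then show False using u1(2)[OF f1(3)] f1(4) z0 by simp
  qed
  then have card2: "p * card A1 \<le> card A2"
    using A1 A2 by (intro psubgroup_card_ge[OF A1(1) A2(1)]) auto
  have A2Z2: "A2 \<subseteq> Z2" by (rule A2_sub[OF Z2 ZZ2]) (use u1 u2 in auto)

  \<comment> \<open>The bound on the order of G forces equalities\<close>
  define K2 where "K2 = {x \<in> carrier G. f2 x = \<one>}"
  \<comment> \<open>The element \<open>a\<close> separates \<open>K\<close> from \<open>K2\<close>,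
    and \<open>b\<close> separates \<open>K2\<close> from \<open>G\<close>, so \<open>K\<close> has
    index at least \<open>p ^ 2\<close>.\<close>
  define K where "K = {x \<in> carrier G. f1 x = \<one>} \<inter> K2"
  have K2: "subgroup K2 G" using f2.subgroup_kernel unfolding K2_def kernel_def by simp
  have K: "subgroup K G"
    using subgroups_Inter_pair[OF f1.subgroup_kernel K2] unfolding K_def kernel_def by simp
  have Z2K: "Z2 \<subseteq> K" unfolding K_def K2_def using f1(2) f2(2) Z2L Z2c by auto
  have "a \<in> K2 - K" unfolding K_def K2_def using f1 f2(2)[OF aL] z0 by auto
  then have card3: "p * card K \<le> card K2"
    by (intro psubgroup_card_ge[OF K K2]) (auto simp: K_def)
  have "b \<in> carrier G - K2" unfolding K2_def using f2 z0 by auto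
  then have card4: "p * card K2 \<le> card (carrier G)"
    using subgroup.subset[OF K2] by (intro psubgroup_card_ge[OF K2 subgroup_self]) auto
  have fin: "finite H" if "subgroup H G" for H
    using finite_subset[OF subgroup.subset[OF that] finite_G] .
  have cG: "card (carrier G) \<le> p ^ 6"
    using order_G n p0 unfolding order_def by (simp add: power_increasing)
  have card_le: "card A2 \<le> card Z2" "card Z2 \<le> card K"
    using card_mono[OF fin[OF Z2] A2Z2] card_mono[OF fin[OF K] Z2K] .
  have c4: "p ^ 2 * card K \<le> p ^ 6"
    using le_trans[OF le_trans[OF mult_le_mono2[OF card3, of p] card4] cG]
    by (simp only: power2_eq_square mult.assoc)
  have c5: "p ^ 2 * card Z \<le> card A2"
    using le_trans[OF mult_le_mono2[OF card1, of p] card2]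
    by (simp only: power2_eq_square mult.assoc)
  have card_K: "card K \<le> p ^ 4"
  proof -
    have "p ^ 2 * card K \<le> p ^ 2 * p ^ 4" using c4 by (simp add: power_add[symmetric])
    then show ?thesis using p0 nat_mult_le_cancel1[of "p ^ 2"] by (metis zero_less_power)
  qed
  have card_A2: "p ^ 4 \<le> card A2"
  proof -
    have "p ^ 2 * p ^ 2 \<le> p ^ 2 * card Z" using card_Z unfolding Z_def by (rule mult_le_mono2)
    from le_trans[OF this c5] show ?thesis by (simp add: power_add[symmetric])
  qed
  \<comment> \<open>The orders of \<open>A2\<close>, \<open>Z2\<close> and \<open>K\<close> are
    squeezed between \<open>p ^ 4\<close> and \<open>p ^ 4\<close>.\<close>
  have A2_eq: "A2 = Z2" and K_eq: "K = Z2" and card_Z2: "card Z2 = p ^ 4"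
    using card_subset_eq[OF fin[OF Z2] A2Z2] card_subset_eq[OF fin[OF K] Z2K] card_K card_A2 card_le by auto
  have card_Z_eq: "card Z = p ^ 2"
  proof -
    have "p ^ 2 * card Z \<le> p ^ 2 * p ^ 2" using c5 card_K card_le by (simp add: power_add[symmetric])
    then have "card Z \<le> p ^ 2"
      using p0 nat_mult_le_cancel1[of "p ^ 2"] by (metis zero_less_power)
    then show ?thesis using card_Z unfolding Z_def by simp
  qed

  \<comment> \<open>Homomorphisms trivial on Z are trivial on Z2, with values in P\<close>
  have Z2P: "commutator G u x \<in> P" if "u \<in> Z2" "x \<in> carrier G" for u x
  proof -
    \<comment> \<open>It suffices to check the generators of \<open>Z2\<close>; for
      \<open>u1\<close> and \<open>u2\<close> the commutators are values of \<open>f1\<close> and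
      \<open>f2\<close>.\<close>
    have "A2 \<subseteq> center_mod G P"
    proof (rule A2_sub)
      show "subgroup (center_mod G P) G" using center_mod_subgroup[OF P(1)] PZ Z_def by simp
      show "Z \<subseteq> center_mod G P" unfolding Z_def by (rule center_subset_center_mod[OF P(1)])
    qed (use u1 u2 f1 f2 Z2c in \<open>auto simp: center_mod_def\<close>)
    then show ?thesis using that unfolding A2_eq by (auto simp: center_mod_def)
  qed
  have Z2_abelian: "commutator G u v = \<one>" if "u \<in> Z2" "v \<in> Z2" for u v
  proof -
    let ?T = "{g \<in> carrier G. \<forall>v \<in> Z2. g \<otimes> v = v \<otimes> g}"
    \<comment> \<open>Again on generators: \<open>u1\<close> and \<open>u2\<close> centralize
      \<open>Z2\<close> because \<open>f1\<close> and \<open>f2\<close> are trivial there.\<close>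
    have "A2 \<subseteq> ?T"
    proof (rule A2_sub)
      show "subgroup ?T G" by (rule centralizer_subgroup[OF subgroup.subset[OF Z2]])
      show "Z \<subseteq> ?T" using centerD Z2c center_carrier unfolding Z_def by fastforce
      have "commutator G u1 v = \<one>" "commutator G u2 v = \<one>" if "v \<in> Z2" for v
        using u1(2) u2(2) f1(2) f2(2) Z2L Z2c that by auto
      then show "u1 \<in> ?T" "u2 \<in> ?T"
        using commutator_eq_one_iff[OF Z2c[OF u1(1)] Z2c] commutator_eq_one_iff[OF Z2c[OF u2(1)] Z2c]
          Z2c[OF u1(1)] Z2c[OF u2(1)] by auto
    qed
    then have "u \<otimes> v = v \<otimes> u" using that unfolding A2_eq by blast
    then show ?thesis using commutator_eq_one_iff[OF Z2c[OF that(1)] Z2c[OF that(2)]] by blast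
  qed
  have hom_Z2: "(\<forall>v \<in> Z2. f v = \<one>) \<and> (\<forall>x \<in> carrier G. f x \<in> P)"
    if "f \<in> hom G C" "\<And>z. z \<in> Z \<Longrightarrow> f z = \<one>" for f
    using inner'[OF that] Z2_abelian Z2P Z2c by metis
  \<comment> \<open>\<open>Z\<close> is cyclic of order \<open>p\<^sup>2\<close>: \<open>P\<close> contains all its elements of order \<open>p\<close>.\<close>
  have exp_p: "\<zeta> \<in> P" if \<zeta>: "\<zeta> \<in> Z" "\<zeta> [^] p = \<one>" for \<zeta>
  proof -
    obtain f y where "f \<in> hom G C" "\<And>h. h \<in> Z2 \<Longrightarrow> f h = \<one>\<^bsub>C\<^esub>" "y \<in> carrier G" "f y = \<zeta>"
      by (rule ex_hom_trivial_on_subgroup[OF C Z2, of \<zeta>]) (use Z2_ne \<zeta> Z_def Z2_def powC in auto)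
    then show ?thesis using hom_Z2[of f] ZZ2 by auto
  qed
  \<comment> \<open>For \<open>c\<close> in \<open>Z\<close> outside \<open>P\<close>, the power
    \<open>c [^] p\<close> is nontrivial of order \<open>p\<close> by \<open>exp_p\<close> and the
    order of \<open>Z\<close>. It generates \<open>P\<close>, so powers of \<open>c\<close> serve as
    roots.\<close>
  have root: "\<exists>d \<in> Z. d [^] p = v" if v: "v \<in> P" for v
  proof -
    have "\<not> Z \<subseteq> P"
    proof
      assume "Z \<subseteq> P"
      then have "card Z \<le> card P" by (rule card_mono[OF fin[OF P(1)]])
      then have "p ^ 2 \<le> p" using card_Z_eq P(2) by linarith
      then show False using p0 by (simp add: power2_eq_square)
    qed
    then obtain c where c: "c \<in> Z" "c \<notin> P" by blast
    have cc: "c \<in> carrier G" using c Zc by simp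
    have cp: "c [^] p \<in> Z" using C.nat_pow_closed[of c p] c powC by simp
    have "c [^]\<^bsub>C\<^esub> (p ^ 2) = \<one>\<^bsub>C\<^esub>"
      using C.pow_order_eq_1[of c] c card_Z_eq by (simp add: order_def)
    then have cpp: "(c [^] p) [^] p = \<one>" using cc by (simp add: powC nat_pow_pow power2_eq_square)
    have cp1: "c [^] p \<noteq> \<one>" using exp_p[of c] c by blast
    let ?Q = "adjoin G {\<one>} (c [^] p)"
    have Q: "subgroup ?Q G" using powers[of "c [^] p"] cpp cc by simp
    have QP: "?Q \<subseteq> P"
      by (rule adjoin_subset[OF P(1)]) (use exp_p[OF cp cpp] subgroup.one_closed[OF P(1)] in auto)
    have "{\<one>} \<subset> ?Q"
      using subset_adjoin[OF triv_subgroup, of "c [^] p"] mem_adjoin[OF triv_subgroup, of "c [^] p"] cp1 cc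
      by auto
    then have "p * card {\<one>} \<le> card ?Q" by (rule psubgroup_card_ge[OF triv_subgroup Q])
    then have "?Q = P"
      using card_seteq[OF fin[OF P(1)] QP] P(2) by simp
    then obtain i :: nat where "v = \<one> \<otimes> (c [^] p) [^] i" using v unfolding adjoin_def by blast
    then have "v = (c [^] i) [^] p" using cc by (simp add: nat_pow_pow mult.commute)
    moreover have "c [^] i \<in> Z" using C.nat_pow_closed[of c i] c powC by simp
    ultimately show ?thesis by blast
  qed

  \<comment> \<open>A nontrivial homomorphism on Z2 that kills Z and [a, b]\<close>
  have pow_Z2: "g [^] p \<in> Z2" if "g \<in> carrier G" for g
  proof -
    have "f1 (g [^] p) = \<one>" "f2 (g [^] p) = \<one>"
      using that f1.hom_nat_pow f2.hom_nat_pow powC f1(5) f2(5) P_pow by auto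
    then show ?thesis using that unfolding K_eq[symmetric] K_def K2_def by simp
  qed
  \<comment> \<open>Commutators die under \<open>f1\<close> and \<open>f2\<close>, whose target is
    abelian, and \<open>Z2\<close> is the intersection of the two kernels.\<close>
  have comm_Z2: "commutator G g h \<in> Z2" if "g \<in> carrier G" "h \<in> carrier G" for g h
  proof -
    have "F (commutator G g h) = \<one>" if "group_hom G C F" for F
    proof -
      interpret F: group_hom G C F by fact
      have "F g \<otimes> F h = F h \<otimes> F g"
        using C.m_comm[of "F g" "F h"] F.hom_closed \<open>g \<in> carrier G\<close> \<open>h \<in> carrier G\<close> by simp
      moreover have "F (commutator G g h) \<otimes> (F h \<otimes> F g) = F g \<otimes> F h"
      proof -
        have "commutator G g h \<otimes> (h \<otimes> g) = g \<otimes> h"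
          using \<open>g \<in> carrier G\<close> \<open>h \<in> carrier G\<close> by (simp add: commutator_def m_assoc inv_mult_cancel)
        then show ?thesis
          using F.hom_mult \<open>g \<in> carrier G\<close> \<open>h \<in> carrier G\<close>
          by (metis Cs(2) commutator_closed m_closed)
      qed
      moreover have "F (commutator G g h) \<in> carrier G" "F h \<in> carrier G" "F g \<in> carrier G"
        using F.hom_closed Zc \<open>g \<in> carrier G\<close> \<open>h \<in> carrier G\<close> by simp_all
      ultimately show ?thesis using r_cancel_one[of "F h \<otimes> F g" "F (commutator G g h)"] by simp
    qed
    then have "f1 (commutator G g h) = \<one>" "f2 (commutator G g h) = \<one>"
      using f1.group_hom_axioms f2.group_hom_axioms by blast+
    then show ?thesis using that unfolding K_eq[symmetric] K_def K2_def by simp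
  qed
  define w where "w = commutator G a b"
  have w: "w \<in> Z2" unfolding w_def using comm_Z2 f1(3) f2(3) by simp
  interpret NW: normalizing_element G Z w p
  proof (rule normalizing[OF Z])
    show "w [^] p \<in> Z" by (rule pow_Z) (use w Z2P in auto)
    show "commutator G w k \<in> Z" if "k \<in> Z" for k using Z2D w Zc that by blast
  qed (use w Z2c in auto)
  define W where "W = adjoin G Z w"
  have W: "subgroup W G" "Z \<subseteq> W" "w \<in> W"
    unfolding W_def using NW.adjoin_subgroup subset_adjoin[OF Z] mem_adjoin[OF Z] w Z2c by auto
  have WZ2: "W \<subseteq> Z2" unfolding W_def by (rule adjoin_subset[OF Z2 ZZ2 w])
  \<comment> \<open>The order of \<open>W\<close> is at most \<open>p ^ 3\<close>, that of
    \<open>Z2\<close> is \<open>p ^ 4\<close>. This leaves room for a nontrivial \<open>h\<close> on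
    \<open>Z2\<close> that is trivial on \<open>W\<close>.\<close>
  have "W \<noteq> Z2"
  proof
    assume "W = Z2"
    then have "p ^ 4 \<le> p * p ^ 2"
      using NW.card_adjoin_le[OF fin[OF Z]] card_Z2 card_Z_eq unfolding W_def by simp
    then have "p ^ 4 \<le> p ^ 3" by (simp add: eval_nat_numeral)
    then show False using p0 by (simp add: power_increasing_iff)
  qed
  obtain m where "finite_p_group (G\<lparr>carrier := Z2\<rparr>) p m" using subgroup_p_group[OF Z2] by blast
  then interpret PZ2: finite_p_group "G\<lparr>carrier := Z2\<rparr>" p m .
  obtain h v0 where h: "h \<in> hom (G\<lparr>carrier := Z2\<rparr>) C" "\<And>k. k \<in> W \<Longrightarrow> h k = \<one>"
    "v0 \<in> Z2" "h v0 = z0" "\<And>x. x \<in> Z2 \<Longrightarrow> h x \<in> P"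
  proof -
    obtain f y where "f \<in> hom (G\<lparr>carrier := Z2\<rparr>) C" "\<And>k. k \<in> W \<Longrightarrow> f k = \<one>\<^bsub>C\<^esub>"
      "y \<in> carrier (G\<lparr>carrier := Z2\<rparr>)" "f y = z0"
      "\<And>x. x \<in> carrier (G\<lparr>carrier := Z2\<rparr>) \<Longrightarrow> \<exists>i::nat. f x = z0 [^]\<^bsub>C\<^esub> i"
      by (rule PZ2.ex_hom_trivial_on_subgroup[OF C subgroup_incl[OF W(1) Z2 WZ2], of z0])
        (use \<open>W \<noteq> Z2\<close> z0 powC in auto)
    then show thesis using that[of f y] z0_pow powC by fastforce
  qed
  have h_mult: "h (k \<otimes> l) = h k \<otimes> h l" if "k \<in> Z2" "l \<in> Z2" for k l
    using h(1) that by (auto simp: hom_def)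
  have h_carrier: "h k \<in> carrier G" if "k \<in> Z2" for k using h(5)[OF that] PZ Zc by blast

  \<comment> \<open>Extension to a and then to b, and the contradiction\<close>
  interpret Na: normalizing_element G Z2 a p
    by (rule normalizing[OF Z2]) (use f1(3) comm_Z2 Z2c pow_Z2 in auto)
  \<comment> \<open>The intended value at \<open>a\<close>. The root exists because \<open>h\<close>
    takes its values in \<open>P\<close>.\<close>
  obtain d1 where d1: "d1 \<in> Z" "d1 [^] p = h (a [^] p)" using root h(5) pow_Z2 f1(3) by blast
  define K1 where "K1 = adjoin G Z2 a"
  have K1: "subgroup K1 G" "Z2 \<subseteq> K1" "a \<in> K1"
    unfolding K1_def using Na.adjoin_subgroup subset_adjoin[OF Z2 f1(3)] mem_adjoin[OF Z2 f1(3)] by auto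
  note K1c = subgroup.mem_carrier[OF K1(1)] and K1m = subgroup.m_closed[OF K1(1)]
  \<comment> \<open>Conjugation by \<open>a\<close> changes \<open>k\<close> only by a factor in
    \<open>Z\<close>, which \<open>h\<close> kills.\<close>
  have h_conj_a: "h (a \<otimes> k \<otimes> inv a) = h k" if k: "k \<in> Z2" for k
  proof -
    have c: "commutator G a k \<in> Z2" "commutator G a k \<in> W" using Z2D(2)[OF k f1(3)] ZZ2 W(2) by auto
    have "h (commutator G a k \<otimes> k) = h k"
      using h_mult[OF c(1) k] h(2)[OF c(2)] h_carrier[OF k] by simp
    then show ?thesis using conj_eq_commutator[OF f1(3)] k Z2c by simp
  qed
  obtain h' where h': "h' \<in> hom (G\<lparr>carrier := K1\<rparr>) C"
    "\<And>k i. k \<in> Z2 \<Longrightarrow> h' (k \<otimes> a [^] (i::nat)) = h k \<otimes>\<^bsub>C\<^esub> d1 [^]\<^bsub>C\<^esub> i"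
    unfolding K1_def
    by (rule Na.hom_extends_to_adjoin[OF C h(1), of d1])
      (use d1 prime_p a_Z2 h_conj_a powC in auto)
  have h'_Z2: "h' k = h k" if "k \<in> Z2" for k
    using h'(2)[OF that, of 0] Z2c[OF that] h_carrier[OF that] by simp
  have h'_mult: "h' (k \<otimes> l) = h' k \<otimes> h' l" if "k \<in> K1" "l \<in> K1" for k l
    using h'(1) that by (auto simp: hom_def)
  have h'_carrier: "h' k \<in> carrier G" if "k \<in> K1" for k
    using h'(1) that Zc by (auto simp: hom_def)
  have b_conj_closed: "b \<otimes> k \<otimes> inv b \<in> K1" if "k \<in> K1" for k
    using conj_eq_commutator[OF f2(3), of k] comm_Z2[OF f2(3), of k] K1(2) K1c K1m that by auto
  interpret Nb: normalizing_element G K1 b p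
    by (rule normalizing[OF K1(1)]) (use f2(3) comm_Z2 K1 K1c pow_Z2 in auto)
  have h'_conj_Z2: "h' (b \<otimes> k \<otimes> inv b) = h' k"
    if "k \<in> K1" "commutator G b k \<in> W" for k
  proof -
    have c: "commutator G b k \<in> Z2" using that(2) WZ2 by blast
    have "h' (commutator G b k \<otimes> k) = h' k"
      using h'_mult[OF subsetD[OF K1(2) c] that(1)] h'_Z2[OF c] h(2)[OF that(2)] h'_carrier[OF that(1)]
      by simp
    then show ?thesis using conj_eq_commutator[OF f2(3)] that K1c by simp
  qed
  \<comment> \<open>Induction on the exponent of \<open>a\<close>: the commutator of
    \<open>b\<close> with an element of \<open>Z2\<close> lies in \<open>Z\<close>, and its
    commutator with \<open>a\<close> is \<open>inv w\<close>. Both lie in \<open>W\<close>, where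
    \<open>h\<close> is trivial.\<close>
  have h'_conj_b: "h' (b \<otimes> k \<otimes> inv b) = h' k" if k: "k \<in> K1" for k
  proof -
    obtain l i where l: "l \<in> Z2" "k = l \<otimes> a [^] (i::nat)" using k unfolding K1_def adjoin_def by blast
    have "l \<otimes> a [^] i \<in> K1 \<and> h' (b \<otimes> (l \<otimes> a [^] i) \<otimes> inv b) = h' (l \<otimes> a [^] i)" for i :: nat
    proof (induction i)
      case 0
      have "commutator G b l \<in> W" using Z2D(2)[OF l(1) f2(3)] W(2) by blast
      then show ?case using h'_conj_Z2[of l] l(1) K1(2) Z2c by auto
    next
      case (Suc i)
      have s: "l \<otimes> a [^] i \<in> K1" using Suc by simp
      have eq: "l \<otimes> a [^] Suc i = (l \<otimes> a [^] i) \<otimes> a"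
        using l(1) Z2c f1(3) by (simp add: m_assoc)
      have "b \<otimes> ((l \<otimes> a [^] i) \<otimes> a) \<otimes> inv b
          = (b \<otimes> (l \<otimes> a [^] i) \<otimes> inv b) \<otimes> (b \<otimes> a \<otimes> inv b)"
        using l(1) Z2c f1(3) f2(3) by (simp add: m_assoc inv_mult_cancel)
      then have "h' (b \<otimes> ((l \<otimes> a [^] i) \<otimes> a) \<otimes> inv b)
          = h' (b \<otimes> (l \<otimes> a [^] i) \<otimes> inv b) \<otimes> h' (b \<otimes> a \<otimes> inv b)"
        using h'_mult b_conj_closed s K1(3) by simp
      also have "h' (b \<otimes> a \<otimes> inv b) = h' a"
      proof (rule h'_conj_Z2[OF K1(3)])
        have "commutator G b a = inv w" unfolding w_def using inv_commutator f1(3) f2(3) by simp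
        then show "commutator G b a \<in> W" using subgroup.m_inv_closed[OF W(1) W(3)] by simp
      qed
      finally show ?case using Suc h'_mult[OF s K1(3)] K1m[OF s K1(3)] eq by simp
    qed
    then show ?thesis using l by simp
  qed
  \<comment> \<open>The homomorphism \<open>f2\<close> kills \<open>Z2\<close> and \<open>a\<close>
    but not \<open>b\<close>, so \<open>b\<close> is new.\<close>
  have K1_K2: "K1 \<subseteq> K2" unfolding K1_def
    by (rule adjoin_subset[OF K2]) (use Z2K \<open>a \<in> K2 - K\<close> K_def in auto)
  have b_K1: "b \<notin> K1" using K1_K2 \<open>b \<in> carrier G - K2\<close> by blast
  \<comment> \<open>Since \<open>b [^] p\<close> lies in \<open>Z2\<close>, the value of
    \<open>h'\<close> there is that of \<open>h\<close>, hence in \<open>P\<close>, and a root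
    exists again.\<close>
  obtain d2 where d2: "d2 \<in> Z" "d2 [^] p = h' (b [^] p)"
    using root[OF h(5)[OF pow_Z2[OF f2(3)]]] h'_Z2[OF pow_Z2[OF f2(3)]] by auto
  obtain h'' where h'': "h'' \<in> hom (G\<lparr>carrier := adjoin G K1 b\<rparr>) C"
    "\<And>k i. k \<in> K1 \<Longrightarrow> h'' (k \<otimes> b [^] (i::nat)) = h' k \<otimes>\<^bsub>C\<^esub> d2 [^]\<^bsub>C\<^esub> i"
    by (rule Nb.hom_extends_to_adjoin[OF C h'(1), of d2])
      (use d2 prime_p b_K1 h'_conj_b powC in auto)
  \<comment> \<open>Two strict steps above \<open>Z2\<close> give order at least
    \<open>p ^ 6\<close>, the upper bound for the order of \<open>G\<close>.\<close>
  have "adjoin G K1 b = carrier G"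
  proof (rule card_seteq[OF finite_G])
    show "adjoin G K1 b \<subseteq> carrier G" using subgroup.subset[OF Nb.adjoin_subgroup] .
    have "p * card K1 \<le> card (adjoin G K1 b)"
      by (rule psubgroup_card_ge[OF K1(1) Nb.adjoin_subgroup])
        (use subset_adjoin[OF K1(1) f2(3)] mem_adjoin[OF K1(1) f2(3)] b_K1 in auto)
    moreover have "p * card Z2 \<le> card K1"
      by (rule psubgroup_card_ge[OF Z2 K1(1)]) (use K1 a_Z2 in auto)
    ultimately have "p * (p * p ^ 4) \<le> card (adjoin G K1 b)"
      using card_Z2 by (metis le_trans mult_le_mono2)
    then show "card (carrier G) \<le> card (adjoin G K1 b)" using cG by (simp add: eval_nat_numeral)
  qed
  then have hom: "h'' \<in> hom G C" using h''(1) by simp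
  have h''_Z2: "h'' k = h k" if "k \<in> Z2" for k
    using h''(2)[of k 0] h'_Z2[OF that] that K1(2) Z2c[OF that] h_carrier[OF that] by auto
  have "h'' z = \<one>" if "z \<in> Z" for z
    using h''_Z2[OF subsetD[OF ZZ2 that]] h(2)[OF subsetD[OF W(2) that]] by simp
  \<comment> \<open>Being trivial on \<open>Z\<close>, the extension must be trivial on
    \<open>Z2\<close> by \<open>hom_Z2\<close>, yet it takes the value \<open>z0\<close> at
    \<open>v0\<close>.\<close>
  then have "h'' v0 = \<one>" using hom_Z2[OF hom] h(3) by blast
  then show False using h''_Z2 h(3,4) z0 by simp
qed

text \<open>The map \<open>\<alpha>\<close> is multiplicative since \<open>f\<close> has central
  values, and it is bijective by finiteness once it is injective. As a central automorphism fixing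
  the center it is inner by \<open>eq\<close>, and cancelling \<open>x\<close> in
  \<open>f x \<otimes> x = u \<otimes> x \<otimes> inv u\<close> gives the commutator.\<close>

lemma (in group) hom_to_center_inner:
  assumes fin: "finite (carrier G)" and eq: "grp_center (InnGroup G) = central_auts_Z G"
    and f: "f \<in> hom G (G\<lparr>carrier := grp_center G\<rparr>)" and kills: "\<And>z. z \<in> grp_center G \<Longrightarrow> f z = \<one>"
  shows "\<exists>u \<in> carrier G. \<forall>x \<in> carrier G. commutator G u x = f x"
proof -
  define \<alpha> where "\<alpha> = (\<lambda>x \<in> carrier G. f x \<otimes> x)"
  have fZ: "f x \<in> grp_center G" if "x \<in> carrier G" for x using f that by (auto simp: hom_def)
  have fm: "f (x \<otimes> y) = f x \<otimes> f y" if "x \<in> carrier G" "y \<in> carrier G" for x y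
    using f that by (auto simp: hom_def)
  note fc = center_carrier[OF fZ]
  have hom: "\<alpha> \<in> hom G G"
  proof (rule homI)
    fix x y assume xy: "x \<in> carrier G" "y \<in> carrier G"
    have "\<alpha> (x \<otimes> y) = f x \<otimes> (f y \<otimes> x) \<otimes> y" using xy fm fc by (simp add: \<alpha>_def m_assoc)
    also have "\<dots> = \<alpha> x \<otimes> \<alpha> y"
      unfolding centerD[OF fZ[OF xy(2)] xy(1), symmetric] using xy fc by (simp add: \<alpha>_def m_assoc)
    finally show "\<alpha> (x \<otimes> y) = \<alpha> x \<otimes> \<alpha> y" .
  qed (simp add: \<alpha>_def fc)
  then interpret A: group_hom G G \<alpha>
    using group_axioms by (simp add: group_hom_def group_hom_axioms_def)
  \<comment> \<open>An element of the kernel is the inverse of the central element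
    \<open>f x\<close>, hence central, and so \<open>f x = \<one>\<close>.\<close>
  have "x = \<one>" if x: "x \<in> carrier G" "\<alpha> x = \<one>" for x
  proof -
    have "f x \<otimes> x = \<one>" using x by (simp add: \<alpha>_def)
    then have "x = inv (f x)" using inv_equality inv_comm x fc by metis
    then have "x \<in> grp_center G" using subgroup.m_inv_closed[OF center_subgroup fZ] x by metis
    then show ?thesis using \<open>f x \<otimes> x = \<one>\<close> kills x by simp
  qed
  then have inj: "inj_on \<alpha> (carrier G)" using A.inj_on_one_iff by blast
  have "\<alpha> ` carrier G = carrier G"
    by (rule endo_inj_surj[OF fin _ inj]) (use A.hom_closed in blast)
  then have "\<alpha> \<in> auto G"
    using hom inj by (simp add: auto_def Bij_def bij_betw_def \<alpha>_def)
  moreover have "inv x \<otimes> \<alpha> x = f x" if "x \<in> carrier G" for x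
    using that fc fZ centerD[OF fZ that, of x] inv_mult_cancel(1)[of x "f x"] by (simp add: \<alpha>_def)
  moreover have "\<alpha> z = z" if "z \<in> grp_center G" for z
    using that kills center_carrier by (simp add: \<alpha>_def)
  ultimately have "\<alpha> \<in> grp_center (InnGroup G)"
    unfolding eq central_auts_Z_def central_auts_def using fZ by auto
  then have "\<alpha> \<in> inner_aut G ` carrier G" by (simp add: grp_center_def InnGroup_def)
  then obtain u where u: "u \<in> carrier G" "\<alpha> = inner_aut G u" by blast
  have "commutator G u x = f x" if x: "x \<in> carrier G" for x
  proof -
    have "f x \<otimes> x = u \<otimes> x \<otimes> inv u"
      using fun_cong[OF u(2), of x] x by (simp add: \<alpha>_def inner_aut_def)
    then have "f x \<otimes> x = commutator G u x \<otimes> x" using conj_eq_commutator u(1) x by simp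
    then show ?thesis using x u(1) fc by simp
  qed
  then show ?thesis using u by blast
qed

text \<open>Indices start at 0 with \<open>G\<close> itself, so index 2 is the third term of the
  lower central series. All commutators are central by assumption, and commutators with central
  elements vanish.\<close>

lemma (in group) lower_central_two_trivial:
  assumes "center_mod G (grp_center G) = carrier G"
  shows "lower_central G 2 = {\<one>}"
proof -
  let ?Z = "grp_center G"
  have c: "commutator G g x \<in> ?Z" if "g \<in> carrier G" "x \<in> carrier G" for g x
    using assms that unfolding center_mod_def by blast
  have "lower_central G 1 \<subseteq> ?Z"
  proof -
    \<comment> \<open>The two commutator conventions differ by inverting both arguments.\<close>
    have "inv g \<otimes> inv x \<otimes> g \<otimes> x \<in> ?Z" if "g \<in> carrier G" "x \<in> carrier G" for g x
      using c[of "inv g" "inv x"] that by (simp add: commutator_def)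
    then show ?thesis
      by (simp add: comm_subgroup_def) (rule generate_subgroup_incl[OF _ center_subgroup], blast)
  qed
  then have "inv h \<otimes> inv k \<otimes> h \<otimes> k = \<one>" if "h \<in> lower_central G 1" "k \<in> carrier G" for h k
    using commutator_center_left[OF subgroup.m_inv_closed[OF center_subgroup], of h "inv k"] that
      center_carrier by (auto simp: commutator_def)
  then have "(\<Union>h \<in> lower_central G 1. \<Union>k \<in> carrier G. {inv h \<otimes> inv k \<otimes> h \<otimes> k}) \<subseteq> {\<one>}"
    by blast
  then have "comm_subgroup G (lower_central G 1) (carrier G) \<subseteq> {\<one>}"
    unfolding comm_subgroup_def by (rule generate_subgroup_incl[OF _ triv_subgroup])
  moreover have "\<one> \<in> comm_subgroup G (lower_central G 1) (carrier G)"
    unfolding comm_subgroup_def by (rule generate.one)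
  ultimately show ?thesis by (simp add: numeral_2_eq_2) blast
qed

text \<open>The trivial subgroup, the intersection of the derived subgroup with the center, and the
  center form a strictly increasing chain. The first step is strict because the derived subgroup is
  normal and nontrivial, as otherwise the second center would be \<open>G\<close>.\<close>

lemma (in finite_p_group) center_card_ge:
  assumes "\<not> grp_center G \<subseteq> derived G (carrier G)" "center_mod G (grp_center G) \<noteq> carrier G"
  shows "p ^ 2 \<le> card (grp_center G)"
proof -
  let ?Z = "grp_center G" and ?D = "derived G (carrier G)"
  have D: "?D \<lhd> G" by (rule derived_self_is_normal)
  note Ds = normal_imp_subgroup[OF D]
  have mem: "commutator G g x \<in> ?D" if "g \<in> carrier G" "x \<in> carrier G" for g x
    unfolding derived_def commutator_def using that by (intro generate.incl) blast
  have "?D \<noteq> {\<one>}"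
  proof
    assume "?D = {\<one>}"
    then have "commutator G g x \<in> ?Z" if "g \<in> carrier G" "x \<in> carrier G" for g x
      using mem[OF that] subgroup.one_closed[OF center_subgroup] by simp
    then show False using assms(2) by (auto simp: center_mod_def)
  qed
  then obtain z where z: "z \<in> ?D \<inter> ?Z" "z \<noteq> \<one>" using normal_inter_center[OF D] by blast
  have I: "subgroup (?D \<inter> ?Z) G" by (rule subgroups_Inter_pair[OF Ds center_subgroup])
  have "{\<one>} \<subset> ?D \<inter> ?Z" using z subgroup.one_closed[OF I] by blast
  then have "p * card {\<one>} \<le> card (?D \<inter> ?Z)" by (rule psubgroup_card_ge[OF triv_subgroup I])
  moreover have "p * card (?D \<inter> ?Z) \<le> card ?Z"
    by (rule psubgroup_card_ge[OF I center_subgroup]) (use assms(1) in blast)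
  ultimately have "p * p \<le> card ?Z" by (metis card_1_singleton_iff le_trans mult.right_neutral mult_le_mono2 One_nat_def)
  then show ?thesis by (simp add: power2_eq_square)
qed

theorem theorem2p3:
  fixes G :: "('a, 'b) monoid_scheme" and p n :: nat
  assumes "Factorial_Ring.prime p"
    and "group G"
    and "finite (carrier G)"
    and "order G = p ^ n"
    and "n \<le> 6"
    and "\<not> grp_center G \<subseteq> derived G (carrier G)"
    and "nilpotency_class G \<ge> 3"
    and "grp_center (InnGroup G) = central_auts_Z G"
    and "central_auts_Z G \<subset> central_auts G"
  shows False
proof -
  interpret finite_p_group G p n
    using assms(1,2,4) by (simp add: finite_p_group_def finite_p_group_axioms_def)
  \<comment> \<open>If this term were trivial, the least index of a trivial term would be at most
    2.\<close>
  have "lower_central G 2 \<noteq> {\<one>\<^bsub>G\<^esub>}"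
    using assms(7) not_less_Least[of 2 "\<lambda>c. lower_central G c = {\<one>\<^bsub>G\<^esub>}"]
    unfolding nilpotency_class_def by linarith
  then have ne: "center_mod G (grp_center G) \<noteq> carrier G"
    using lower_central_two_trivial by blast
  show False
    by (rule hom_to_center_not_all_inner[OF assms(5) center_card_ge[OF assms(6) ne] ne])
      (rule hom_to_center_inner[OF assms(3,8)])
qed

end
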